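(* For every $\varepsilon>0$ there exists an offline algorithm $A$ for the up-down run generation problem with buffer size $M$ that always writes an output $S$ satisfying $R(S)\le(1+\varepsilon)\,\mathrm{OPT}$, and whose running time is $O(2^{1/\varepsilon}N\log N)$, where $N$ is the input length.
   Context: Up-down run generation problem: an input stream $I$ of $N$ elements from a totally ordered set is presented in order to an algorithm with a buffer of $M$ slots; the algorithm reads elements in order into the buffer and writes elements from the buffer to an output sequence $S$, each write freeing a slot that is filled by the next input element. In the offline version, the entire input is known in advance and the goal is to compute (in polynomial time) a strategy which, executed by such a buffer-$M$ algorithm, produces few runs. A run is a sorted or reverse-sorted sequence; $R(S)$ is the smallest $k$ such that $S$ is a concatenation of $k$ runs; $\mathrm{OPT}$ is the minimum of $R(S)$ over all outputs achievable on $I$ with buffer size $M$. *)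

theory Defs
  imports Complex_Main
begin

section \<open>The buffer, runs, and the offline optimum\<close>

text \<open>
  Input elements are identified by their position in the input \<open>I\<close>, so that equal elements
  occupy distinct buffer slots. A strategy is the list of positions in the order in which they are
  written. In \<open>executable N B r ps\<close>, \<open>B\<close> is the set of positions in the buffer and \<open>r\<close> is the next
  position to be read from an input of length \<open>N\<close>. All of the input must eventually be written.
\<close>

fun executable :: "nat \<Rightarrow> nat set \<Rightarrow> nat \<Rightarrow> nat list \<Rightarrow> bool" where
  "executable N B r [] \<longleftrightarrow> B = {} \<and> r = N"
| "executable N B r (p # ps) \<longleftrightarrow> p \<in> B \<and>
     (if r < N then executable N (insert r (B - {p})) (Suc r) ps
      else executable N (B - {p}) r ps)"

definition strategy :: "nat \<Rightarrow> nat \<Rightarrow> nat list \<Rightarrow> bool" where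
  "strategy M N ps \<longleftrightarrow> executable N {..<min M N} (min M N) ps"

definition written :: "'a list \<Rightarrow> nat list \<Rightarrow> 'a list" where
  "written I ps = map (\<lambda>p. I ! p) ps"

definition is_run :: "'a::linorder list \<Rightarrow> bool" where
  "is_run xs \<longleftrightarrow> sorted xs \<or> sorted (rev xs)"

definition R :: "'a::linorder list \<Rightarrow> nat" where
  "R S = (LEAST k. \<exists>rs. length rs = k \<and> concat rs = S \<and> (\<forall>r\<in>set rs. is_run r))"

definition OPT :: "nat \<Rightarrow> 'a::linorder list \<Rightarrow> nat" where
  "OPT M I = (LEAST k. \<exists>ps. strategy M (length I) ps \<and> R (written I ps) = k)"


section \<open>Offline algorithms and their running time\<close>

text \<open>
  Algorithms are programs for a comparison-based unit-cost RAM: registers and an addressable memory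
  hold natural numbers, and the only arithmetic is addition and (truncated) subtraction. The input
  elements are never available as numbers; they can only be compared with each other, via their
  positions (\<open>KeyLe\<close>, false if a position is out of range). Programs are syntactic objects that do
  not depend on the input, and every evaluated expression node and every executed
  command costs one step, so a program cannot hide work in large expressions. \<open>Emit\<close> appends a
  position to the write-only result, which is the computed strategy.
\<close>

datatype aexp =
    Const nat
  | Var string
  | Add aexp aexp
  | Sub aexp aexp
  | Load aexp

datatype bexp =
    Less aexp aexp
  | KeyLe aexp aexp
  | Neg bexp
  | Conj bexp bexp

datatype com =
    Skip
  | Assign string aexp
  | Store aexp aexp
  | Emit aexp
  | Seq com com
  | If bexp com com
  | While bexp com

record state =
  reg :: "string \<Rightarrow> nat"
  mem :: "nat \<Rightarrow> nat"
  emitted :: "nat list"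

fun aval :: "aexp \<Rightarrow> state \<Rightarrow> nat" where
  "aval (Const n) s = n"
| "aval (Var x) s = reg s x"
| "aval (Add a b) s = aval a s + aval b s"
| "aval (Sub a b) s = aval a s - aval b s"
| "aval (Load a) s = mem s (aval a s)"

fun acost :: "aexp \<Rightarrow> nat" where
  "acost (Const n) = 1"
| "acost (Var x) = 1"
| "acost (Add a b) = 1 + acost a + acost b"
| "acost (Sub a b) = 1 + acost a + acost b"
| "acost (Load a) = 1 + acost a"

fun bval :: "'a::linorder list \<Rightarrow> bexp \<Rightarrow> state \<Rightarrow> bool" where
  "bval I (Less a b) s \<longleftrightarrow> aval a s < aval b s"
| "bval I (KeyLe a b) s \<longleftrightarrow>
     aval a s < length I \<and> aval b s < length I \<and> I ! aval a s \<le> I ! aval b s"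
| "bval I (Neg b) s \<longleftrightarrow> \<not> bval I b s"
| "bval I (Conj b c) s \<longleftrightarrow> bval I b s \<and> bval I c s"

fun bcost :: "bexp \<Rightarrow> nat" where
  "bcost (Less a b) = 1 + acost a + acost b"
| "bcost (KeyLe a b) = 1 + acost a + acost b"
| "bcost (Neg b) = 1 + bcost b"
| "bcost (Conj b c) = 1 + bcost b + bcost c"

text \<open>\<open>exec I c s t s'\<close>: on input \<open>I\<close>, the program \<open>c\<close> started in \<open>s\<close> halts after \<open>t\<close> steps in \<open>s'\<close>.\<close>

inductive exec :: "'a::linorder list \<Rightarrow> com \<Rightarrow> state \<Rightarrow> nat \<Rightarrow> state \<Rightarrow> bool" for I where
  Skip: "exec I Skip s 1 s"
| Assign: "exec I (Assign x a) s (1 + acost a) (s\<lparr>reg := (reg s)(x := aval a s)\<rparr>)"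
| Store: "exec I (Store a b) s (1 + acost a + acost b) (s\<lparr>mem := (mem s)(aval a s := aval b s)\<rparr>)"
| Emit: "exec I (Emit a) s (1 + acost a) (s\<lparr>emitted := emitted s @ [aval a s]\<rparr>)"
| Seq: "exec I c s t s' \<Longrightarrow> exec I d s' t' s'' \<Longrightarrow> exec I (Seq c d) s (1 + t + t') s''"
| IfTrue: "bval I b s \<Longrightarrow> exec I c s t s' \<Longrightarrow> exec I (If b c d) s (1 + bcost b + t) s'"
| IfFalse: "\<not> bval I b s \<Longrightarrow> exec I d s t s' \<Longrightarrow> exec I (If b c d) s (1 + bcost b + t) s'"
| WhileFalse: "\<not> bval I b s \<Longrightarrow> exec I (While b c) s (1 + bcost b) s"
| WhileTrue: "bval I b s \<Longrightarrow> exec I c s t s' \<Longrightarrow> exec I (While b c) s' t' s'' \<Longrightarrow>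
    exec I (While b c) s (1 + bcost b + t + t') s''"

definition init :: "nat \<Rightarrow> 'a list \<Rightarrow> state" where
  "init M I = \<lparr>reg = (\<lambda>_. 0)(''N'' := length I, ''M'' := M), mem = (\<lambda>_. 0), emitted = []\<rparr>"

definition computes :: "com \<Rightarrow> nat \<Rightarrow> 'a::linorder list \<Rightarrow> nat \<Rightarrow> nat list \<Rightarrow> bool" where
  "computes A M I t ps \<longleftrightarrow> (\<exists>s. exec I A (init M I) t s \<and> emitted s = ps)"


section \<open>Well-definedness\<close>

lemma exec_deterministic:
  "exec I c s t s' \<Longrightarrow> exec I c s u s'' \<Longrightarrow> t = u \<and> s' = s''"
proof (induction arbitrary: u s'' rule: exec.induct)
  case (Seq c s t s' d t' s'')
  from Seq.prems show ?case by cases (use Seq.IH in blast)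
next
  case (IfTrue b s c t s' d)
  from IfTrue.prems show ?case by cases (use IfTrue in blast)+
next
  case (IfFalse b s d t s' c)
  from IfFalse.prems show ?case by cases (use IfFalse in blast)+
next
  case (WhileFalse b s c)
  from WhileFalse.prems show ?case by cases (use WhileFalse in blast)+
next
  case (WhileTrue b s c t s' t' s'')
  from WhileTrue.prems show ?case by cases (use WhileTrue in blast)+
qed (auto elim: exec.cases)

lemma computes_deterministic:
  "computes A M I t ps \<Longrightarrow> computes A M I u qs \<Longrightarrow> t = u \<and> ps = qs"
  unfolding computes_def using exec_deterministic by blast

lemma R_decomposition:
  "\<exists>rs. length rs = R S \<and> concat rs = S \<and> (\<forall>r\<in>set rs. is_run r)"
  unfolding R_def
proof (rule LeastI)
  show "\<exists>rs. length rs = length S \<and> concat rs = S \<and> (\<forall>r\<in>set rs. is_run r)"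
    by (rule exI[of _ "map (\<lambda>x. [x]) S"]) (auto simp: is_run_def)
qed

lemma executable_upt:
  assumes "i < r \<or> r = N" "i \<le> r" "r \<le> N"
  shows "executable N {i..<r} r [i..<N]"
  using assms
proof (induction "N - i" arbitrary: i r)
  case 0
  then show ?case by auto
next
  case (Suc k)
  have "insert r ({i..<r} - {i}) = {Suc i..<Suc r}" "{i..<r} - {i} = {Suc i..<r}"
    using Suc.hyps(2) Suc.prems by auto
  moreover have "[i..<N] = i # [Suc i..<N]" using Suc.hyps(2) by (simp add: upt_rec)
  ultimately show ?case
    using Suc.hyps Suc.prems by auto
qed

lemma strategy_upt: "1 \<le> M \<Longrightarrow> strategy M N [0..<N]"
  using executable_upt[of 0 "min M N" N] by (cases "N = 0") (auto simp: strategy_def lessThan_atLeast0)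

lemma OPT_attained:
  assumes "1 \<le> M"
  shows "\<exists>ps. strategy M (length I) ps \<and> R (written I ps) = OPT M I"
  unfolding OPT_def by (rule LeastI_ex) (use strategy_upt[OF assms] in blast)

end

theory Submission
  imports Defs "HOL-Combinatorics.Permutations"
begin

text \<open>
  Among all runs in a given direction that can be written from the current buffer, the greedy one
  (always write the next possible element) writes a superset of any other, and deleting elements
  from the unwritten part never hurts. Hence the greedy runs for the direction sequence of an
  optimal output stay ahead of that output. With \<open>k = \<lceil>1 / \<epsilon>\<rceil>\<close>, the algorithm repeatedly simulates
  all direction sequences of length at most \<open>k\<close>, commits to a shortest one among those that write
  most elements, and writes one further run. That run empties the buffer, so that everything an
  optimal output has written in \<open>k\<close> runs is written after \<open>k + 1\<close> runs; the last window, in which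
  everything can be written, is optimal by itself.

  A greedy run is produced by replacement selection with a binary heap. It writes at least the
  initial content of the buffer, which pays for restoring the buffer and for building the heap, and
  every simulation in a window writes at most as many elements as the window commits. This bounds
  the cost of a window by \<open>O(2 ^ k log N)\<close> per element written.
\<close>

section \<open>Greedy runs\<close>

text \<open>Progress is recorded as the set \<open>U\<close> of unwritten positions instead of a
  buffer with a read pointer. The buffer is then a function of \<open>U\<close>, and deleting
  arbitrary elements stays inside the model even if no strategy reaches the resulting set; this is
  what makes a monotonicity argument possible. The obstacle is that the sets left by two direction
  sequences are in general incomparable, whereas a program can cheaply compare only how many
  positions were written. Monotonicity needs an inclusion, and obtaining one from a comparison of
  sizes costs the single extra run per window, hence the ratio \<open>(k + 1) / k\<close>. There are
  \<open>2 ^ (k + 1) - 1\<close> sequences of length at most \<open>k\<close>. As \<open>k\<close>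
  is at most \<open>1 / \<epsilon> + 1\<close>, this is at most four times
  \<open>2 powr (1 / \<epsilon>)\<close>. The sequences are expanded into the program text, so that
  the program depends on \<open>\<epsilon>\<close> but on neither \<open>M\<close> nor the
  input.\<close>

definition key_le :: "'a::linorder list \<Rightarrow> bool \<Rightarrow> nat \<Rightarrow> nat \<Rightarrow> bool" where
  "key_le I d p q \<longleftrightarrow> (if d then I ! p \<le> I ! q else I ! q \<le> I ! p)"

lemma key_le_refl [simp]: "key_le I d p p"
  by (simp add: key_le_def)

lemma key_le_trans: "key_le I d p q \<Longrightarrow> key_le I d q r \<Longrightarrow> key_le I d p r"
  by (auto simp: key_le_def split: if_splits)

lemma key_le_total: "\<not> key_le I d p q \<Longrightarrow> key_le I d q p"
  by (auto simp: key_le_def split: if_splits)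

section \<open>Sets of unwritten positions and the sequences they admit\<close>

text \<open>These are the \<open>M\<close> least positions of \<open>U\<close>: input is read in
  order, so the buffer always holds the earliest unwritten positions. The formula makes sense for
  every \<open>U\<close>, reachable or not.\<close>

definition buffer :: "nat \<Rightarrow> nat set \<Rightarrow> nat set" where
  "buffer M U = {p \<in> U. card {q \<in> U. q < p} < M}"

fun writable :: "nat \<Rightarrow> nat set \<Rightarrow> nat list \<Rightarrow> bool" where
  "writable M U [] \<longleftrightarrow> True"
| "writable M U (p # ps) \<longleftrightarrow> p \<in> buffer M U \<and> writable M (U - {p}) ps"

lemma buffer_subset: "buffer M U \<subseteq> U"
  by (auto simp: buffer_def)

lemma buffer_antimono:
  assumes "finite U" "V \<subseteq> U" "p \<in> buffer M U" "p \<in> V"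
  shows "p \<in> buffer M V"
proof -
  have "card {q \<in> V. q < p} \<le> card {q \<in> U. q < p}"
    using assms by (intro card_mono) auto
  then show ?thesis using assms by (auto simp: buffer_def)
qed

lemma writable_append:
  "writable M U (xs @ ys) \<longleftrightarrow> writable M U xs \<and> writable M (U - set xs) ys"
proof (induction xs arbitrary: U)
  case (Cons x xs)
  have "U - insert x (set xs) = U - {x} - set xs" by blast
  then show ?case using Cons by simp
qed simp

lemma writable_subset: "writable M U xs \<Longrightarrow> set xs \<subseteq> U"
  by (induction xs arbitrary: U) (auto simp: buffer_def)

lemma writable_distinct: "writable M U xs \<Longrightarrow> distinct xs"
proof (induction xs arbitrary: U)
  case (Cons x xs)
  then show ?case using writable_subset[of M "U - {x}" xs] by auto
qed simp

text \<open>Deleted positions are simply skipped. A deletion can only lower the rank of the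
  positions that stay, so each of them is still in the buffer when its turn comes.\<close>

lemma writable_filter:
  assumes "finite U" "V \<subseteq> U" "writable M U xs"
  shows "writable M V (filter (\<lambda>x. x \<in> V) xs)"
  using assms
proof (induction xs arbitrary: U V)
  case (Cons x xs)
  show ?case
  proof (cases "x \<in> V")
    case True
    have "filter (\<lambda>y. y \<in> V) xs = filter (\<lambda>y. y \<in> V - {x}) xs"
      using writable_distinct[OF Cons.prems(3)] by (auto intro: filter_cong)
    moreover have "writable M (V - {x}) (filter (\<lambda>y. y \<in> V - {x}) xs)"
      using Cons.prems by (intro Cons.IH[of "U - {x}"]) auto
    ultimately show ?thesis
      using True Cons.prems buffer_antimono[of U V x M] by simp
  next
    case False
    then show ?thesis using Cons.prems Cons.IH[of "U - {x}" V] by auto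
  qed
qed simp

text \<open>
  What a maximal run leaves: it writes everything that any run in the same direction could write
  (see \<open>greedy_rest\<close>).
\<close>

definition rest :: "nat \<Rightarrow> 'a::linorder list \<Rightarrow> bool \<Rightarrow> nat set \<Rightarrow> nat set" where
  "rest M I d U = U - \<Union>{set X |X. writable M U X \<and> sorted_wrt (key_le I d) X}"

definition rests :: "nat \<Rightarrow> 'a::linorder list \<Rightarrow> bool list \<Rightarrow> nat set \<Rightarrow> nat set" where
  "rests M I ds U = fold (rest M I) ds U"

lemma rests_simps [simp]:
  "rests M I [] U = U" "rests M I (d # ds) U = rests M I ds (rest M I d U)"
  by (auto simp: rests_def)

lemma rests_append: "rests M I (ds @ es) U = rests M I es (rests M I ds U)"
  by (simp add: rests_def)

lemma rest_subset: "rest M I d U \<subseteq> U"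
  by (auto simp: rest_def)

lemma rests_subset: "rests M I ds U \<subseteq> U"
proof (induction ds arbitrary: U)
  case (Cons d ds)
  have "rests M I ds (rest M I d U) \<subseteq> rest M I d U" by (rule Cons)
  also have "\<dots> \<subseteq> U" by (rule rest_subset)
  finally show ?case by simp
qed simp

text \<open>A run from \<open>U\<close> restricted to \<open>V\<close> is a run from
  \<open>V\<close>, so whatever no run from \<open>V\<close> reaches is not reached from
  \<open>U\<close> either.\<close>

lemma rest_mono:
  assumes "finite U" "V \<subseteq> U"
  shows "rest M I d V \<subseteq> rest M I d U"
proof
  fix x assume x: "x \<in> rest M I d V"
  have "x \<notin> set X" if X: "writable M U X" "sorted_wrt (key_le I d) X" for X
  proof
    assume "x \<in> set X"
    then have "x \<in> set (filter (\<lambda>x. x \<in> V) X)" using x by (simp add: rest_def)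
    moreover have "sorted_wrt (key_le I d) (filter (\<lambda>x. x \<in> V) X)"
      using X(2) by (rule sorted_wrt_filter)
    ultimately show False
      using writable_filter[OF assms X(1)] x unfolding rest_def by blast
  qed
  then show "x \<in> rest M I d U" using x assms(2) by (auto simp: rest_def)
qed

lemma rests_mono:
  assumes "finite U" "V \<subseteq> U"
  shows "rests M I ds V \<subseteq> rests M I ds U"
  using assms
proof (induction ds arbitrary: U V)
  case (Cons d ds)
  have "finite (rest M I d U)"
    using Cons.prems(1) rest_subset by (rule finite_subset[rotated])
  then show ?case
    using Cons.IH[OF _ rest_mono[OF Cons.prems]] by simp
qed simp

text \<open>A single element is a run in either direction. This is why one run, whatever its
  direction, clears the old buffer.\<close>

lemma rest_buffer: "rest M I d U \<subseteq> U - buffer M U"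
proof
  fix p assume p: "p \<in> rest M I d U"
  have "p \<notin> buffer M U"
  proof
    assume "p \<in> buffer M U"
    then have "writable M U [p] \<and> sorted_wrt (key_le I d) [p]" by simp
    moreover have "p \<in> set [p]" by simp
    ultimately show False using p unfolding rest_def by blast
  qed
  then show "p \<in> U - buffer M U" using p by (auto simp: rest_def)
qed

lemma rest_writable:
  "writable M U X \<Longrightarrow> sorted_wrt (key_le I d) X \<Longrightarrow> rest M I d U \<subseteq> U - set X"
  by (auto simp: rest_def)

text \<open>The maximal run leaves no more than \<open>X\<close> does, and by
  \<open>rests_mono\<close> this advantage survives all later runs.\<close>

lemma rests_writable:
  assumes "finite U" "writable M U (concat Xs)" "list_all2 (\<lambda>d X. sorted_wrt (key_le I d) X) ds Xs"
  shows "rests M I ds U \<subseteq> U - set (concat Xs)"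
  using assms(3,1,2)
proof (induction arbitrary: U rule: list_all2_induct)
  case (Cons d ds X Xs)
  have X: "writable M U X" "writable M (U - set X) (concat Xs)"
    using Cons.prems by (auto simp: writable_append)
  have "rests M I (d # ds) U \<subseteq> rests M I ds (U - set X)"
    using rests_mono[OF _ rest_writable[OF X(1) Cons.hyps(1)], of M I ds] Cons.prems(1) by simp
  also have "\<dots> \<subseteq> U - set X - set (concat Xs)"
    using Cons.IH[OF _ X(2)] Cons.prems(1) by simp
  finally show ?case by auto
qed simp

section \<open>Greedy runs are maximal\<close>

text \<open>A relation rather than a function: among equal keys any choice is allowed, so that
  whatever a heap happens to put at its root is covered.\<close>

inductive greedy :: "nat \<Rightarrow> 'a::linorder list \<Rightarrow> bool \<Rightarrow> nat set \<Rightarrow> nat list \<Rightarrow> bool" for M I d U where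
  greedy_Nil: "greedy M I d U []"
| greedy_snoc: "greedy M I d U xs \<Longrightarrow> p \<in> buffer M (U - set xs) \<Longrightarrow> \<forall>y\<in>set xs. key_le I d y p \<Longrightarrow>
    \<forall>q\<in>buffer M (U - set xs). (\<forall>y\<in>set xs. key_le I d y q) \<longrightarrow> key_le I d p q \<Longrightarrow>
    greedy M I d U (xs @ [p])"

lemma greedy_run: "greedy M I d U xs \<Longrightarrow> writable M U xs \<and> sorted_wrt (key_le I d) xs"
  by (induction rule: greedy.induct) (auto simp: writable_append sorted_wrt_append)

text \<open>\<open>D\<close> stands for what a competing run wrote before \<open>x\<close>. If the
  last greedy element \<open>p\<close> is in \<open>D\<close>, then \<open>x\<close> follows
  \<open>p\<close>, and \<open>p\<close> follows everything before it. Otherwise \<open>D\<close>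
  was already written before \<open>p\<close>, so \<open>x\<close> was in the buffer and a candidate
  when \<open>p\<close> was chosen as the minimum.\<close>

lemma greedy_le:
  assumes "greedy M I d U xs" "finite U" "D \<subseteq> set xs" "x \<in> buffer M (U - D)" "x \<notin> set xs"
    "\<forall>z\<in>D. key_le I d z x"
  shows "\<forall>y\<in>set xs. key_le I d y x"
  using assms
proof (induction rule: greedy.induct)
  case (greedy_snoc xs p)
  show ?case
  proof (cases "p \<in> D")
    case True
    then have "key_le I d p x" using greedy_snoc.prems(5) by blast
    moreover have "key_le I d y p" if "y \<in> set (xs @ [p])" for y
      using that greedy_snoc.hyps(3) by (cases "y = p") auto
    ultimately show ?thesis using key_le_trans by blast
  next
    case False
    then have D: "D \<subseteq> set xs" using greedy_snoc.prems by auto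
    have le: "\<forall>y\<in>set xs. key_le I d y x"
      using greedy_snoc.prems by (intro greedy_snoc.IH D) auto
    have "x \<in> buffer M (U - set xs)"
      by (rule buffer_antimono[of "U - D"])
        (use greedy_snoc.prems D buffer_subset[of M "U - D"] in auto)
    then have "key_le I d p x" using le greedy_snoc.hyps(4) by blast
    then show ?thesis using le by simp
  qed
qed simp

text \<open>The first element of \<open>X\<close> missing from \<open>xs\<close> would, by
  \<open>greedy_le\<close>, be a legal continuation of the greedy run, which is assumed to be
  stuck.\<close>

lemma greedy_dominates:
  assumes "greedy M I d U xs" "finite U"
    "\<forall>q\<in>buffer M (U - set xs). \<exists>y\<in>set xs. \<not> key_le I d y q"
    "writable M U X" "sorted_wrt (key_le I d) X"
  shows "set X \<subseteq> set xs"
  using assms(4,5)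
proof (induction X rule: rev_induct)
  case (snoc x X)
  then have X: "set X \<subseteq> set xs" "x \<in> buffer M (U - set X)" "\<forall>z\<in>set X. key_le I d z x"
    by (auto simp: writable_append sorted_wrt_append)
  have "x \<in> set xs"
  proof (rule ccontr)
    assume x: "x \<notin> set xs"
    have "\<forall>y\<in>set xs. key_le I d y x"
      using greedy_le[OF assms(1,2) X(1,2) x X(3)] .
    moreover have "x \<in> buffer M (U - set xs)"
      by (rule buffer_antimono[of "U - set X"])
        (use assms(2) X x buffer_subset[of M "U - set X"] in auto)
    ultimately show False using assms(3) by auto
  qed
  then show ?case using X by simp
qed simp

lemma greedy_rest:
  assumes "greedy M I d U xs" "finite U"
    "\<forall>q\<in>buffer M (U - set xs). \<exists>y\<in>set xs. \<not> key_le I d y q"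
  shows "rest M I d U = U - set xs"
  using greedy_dominates[OF assms] greedy_run[OF assms(1)] unfolding rest_def by blast

lemma greedy_exists:
  assumes "finite U"
  shows "\<exists>xs. greedy M I d U xs \<and> (\<forall>q\<in>buffer M (U - set xs). \<exists>y\<in>set xs. \<not> key_le I d y q)"
proof -
  have "\<exists>ys. greedy M I d U ys \<and> (\<forall>q\<in>buffer M (U - set ys). \<exists>y\<in>set ys. \<not> key_le I d y q)"
    if "greedy M I d U xs" for xs
    using that
  proof (induction "card (U - set xs)" arbitrary: xs rule: less_induct)
    case less
    let ?Q = "{q \<in> buffer M (U - set xs). \<forall>y\<in>set xs. key_le I d y q}"
    show ?case
    proof (cases "?Q = {}")
      case True
      then show ?thesis using less.prems by blast
    next
      case False
      have fin: "finite ?Q" using assms by (simp add: buffer_def)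
      have "\<exists>p\<in>?Q. \<forall>q\<in>?Q. key_le I d p q"
        using fin False
      proof (induction rule: finite_ne_induct)
        case (insert x F)
        then obtain p where p: "p \<in> F" "\<forall>q\<in>F. key_le I d p q" by blast
        show ?case
        proof (cases "key_le I d p x")
          case True
          then show ?thesis using p by blast
        next
          case False
          then have "\<forall>q\<in>insert x F. key_le I d x q"
            using p key_le_total[OF False] key_le_trans[of I d x p] by auto
          then show ?thesis by blast
        qed
      qed simp
      then obtain p where p: "p \<in> ?Q" "\<forall>q\<in>?Q. key_le I d p q" by blast
      then have g: "greedy M I d U (xs @ [p])"
        using less.prems by (auto intro: greedy_snoc)
      have "p \<in> U - set xs" using p buffer_subset by auto
      then have "card (U - set (xs @ [p])) < card (U - set xs)"
        using assms by (intro psubset_card_mono) auto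
      then show ?thesis using less.hyps g by blast
    qed
  qed
  then show ?thesis using greedy_Nil by blast
qed

section \<open>Agreement of the set model with the buffer machine\<close>

text \<open>\<open>B\<close> is the buffer and \<open>r\<close> the number of positions read so far.\<close>

definition unwritten :: "nat \<Rightarrow> nat \<Rightarrow> nat set \<Rightarrow> nat \<Rightarrow> nat set \<Rightarrow> bool" where
  "unwritten M N B r U \<longleftrightarrow> U = B \<union> {r..<N} \<and> B \<subseteq> {..<r} \<and> r \<le> N \<and> card B \<le> M \<and> (r < N \<longrightarrow> card B = M)"

text \<open>Below a buffered position only other buffered positions are unwritten, fewer than
  \<open>M\<close>. Below an unread position lies the entire buffer, which is full as long as
  something is unread.\<close>

lemma unwritten_buffer:
  assumes "unwritten M N B r U"
  shows "buffer M U = B"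
proof -
  have U: "U = B \<union> {r..<N}" "B \<subseteq> {..<r}" "r \<le> N" "card B \<le> M" "r < N \<Longrightarrow> card B = M"
    using assms by (auto simp: unwritten_def)
  have fin: "finite B" using U(2) finite_subset by blast
  have "card {q \<in> U. q < p} < M" if "p \<in> B" for p
  proof -
    have "{q \<in> U. q < p} \<subseteq> B - {p}" using U that by auto
    then have "card {q \<in> U. q < p} \<le> card (B - {p})" using fin by (intro card_mono) auto
    also have "\<dots> < card B" using fin that by (intro psubset_card_mono) auto
    finally show ?thesis using U by simp
  qed
  moreover have "\<not> card {q \<in> U. q < p} < M" if "p \<in> {r..<N}" for p
  proof -
    have "card B \<le> card {q \<in> U. q < p}" using U that by (intro card_mono) auto
    then show ?thesis using U that by auto
  qed
  ultimately show ?thesis using U by (auto simp: buffer_def)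
qed

lemma unwritten_step:
  assumes "unwritten M N B r U" "p \<in> B"
  shows "if r < N then unwritten M N (insert r (B - {p})) (Suc r) (U - {p})
    else unwritten M N (B - {p}) r (U - {p})"
proof -
  have U: "U = B \<union> {r..<N}" "B \<subseteq> {..<r}" "r \<le> N" "card B \<le> M" "r < N \<Longrightarrow> card B = M"
    using assms by (auto simp: unwritten_def)
  have fin: "finite B" using U(2) finite_subset by blast
  have c: "card (B - {p}) = card B - 1" "card B > 0"
    using assms fin by (auto simp: card_gt_0_iff)
  have "r \<notin> B" using U(2) by auto
  then have "card (insert r (B - {p})) = card B" using fin c by simp
  then show ?thesis using U assms(2) c unfolding unwritten_def
    by (auto simp del: card_Diff_insert)
qed

text \<open>Transfers the machine of the problem statement to the set model;
  \<open>set ps = U\<close> expresses that the machine halts with everything read and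
  written.\<close>

lemma executable_writable:
  assumes "unwritten M N B r U"
  shows "executable N B r ps \<longleftrightarrow> writable M U ps \<and> set ps = U"
  using assms
proof (induction ps arbitrary: B r U)
  case Nil
  then show ?case by (auto simp: unwritten_def)
next
  case (Cons p ps)
  have b: "buffer M U = B" using unwritten_buffer[OF Cons.prems] .
  show ?case
  proof (cases "p \<in> B")
    case True
    have "p \<in> U" using True b buffer_subset by blast
    have "set ps = U - {p} \<longleftrightarrow> insert p (set ps) = U" if "writable M (U - {p}) ps"
      using writable_subset[OF that] \<open>p \<in> U\<close> by auto
    then show ?thesis
      using True b unwritten_step[OF Cons.prems True] Cons.IH by (auto split: if_splits)
  next
    case False
    then show ?thesis using b by simp
  qed
qed

lemma unwritten_start: "unwritten M N {..<min M N} (min M N) {..<N}"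
  by (auto simp: unwritten_def)

lemma strategy_writable: "strategy M N ps \<longleftrightarrow> writable M {..<N} ps \<and> set ps = {..<N}"
  unfolding strategy_def by (rule executable_writable[OF unwritten_start])

lemma unwritten_writable:
  assumes "unwritten M N B r U" "writable M U xs"
  shows "\<exists>B r. unwritten M N B r (U - set xs)"
  using assms
proof (induction xs arbitrary: B r U)
  case (Cons x xs)
  have "x \<in> B" using Cons.prems unwritten_buffer by fastforce
  then obtain B' r' where "unwritten M N B' r' (U - {x})"
    using unwritten_step[OF Cons.prems(1)] by meson
  then have "\<exists>B r. unwritten M N B r (U - {x} - set xs)" using Cons by simp
  moreover have "U - {x} - set xs = U - set (x # xs)" by auto
  ultimately show ?case by simp
qed auto

lemma unwritten_finite: "unwritten M N B r U \<Longrightarrow> finite U"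
  unfolding unwritten_def using finite_subset by blast

lemma unwritten_rest:
  assumes "unwritten M N B r U"
  shows "\<exists>B r. unwritten M N B r (rest M I d U)"
proof -
  obtain xs where "greedy M I d U xs" "rest M I d U = U - set xs"
    using greedy_exists[OF unwritten_finite[OF assms]] greedy_rest[OF _ unwritten_finite[OF assms]]
    by metis
  then show ?thesis using unwritten_writable[OF assms] greedy_run by metis
qed

lemma unwritten_rests:
  "unwritten M N B r U \<Longrightarrow> \<exists>B r. unwritten M N B r (rests M I ds U)"
proof (induction ds arbitrary: B r U)
  case (Cons d ds)
  obtain C q where "unwritten M N C q (rest M I d U)"
    using unwritten_rest[OF Cons.prems] by blast
  then show ?case using Cons.IH by simp
qed auto

text \<open>Consequently \<open>r - card B\<close> is the number of positions written so far, a
  quantity that the program reads off two registers.\<close>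

lemma unwritten_card:
  assumes "unwritten M N B r U"
  shows "card U + r = card B + N"
proof -
  have "finite B" using assms unfolding unwritten_def using finite_subset by blast
  then have "card (B \<union> {r..<N}) = card B + card {r..<N}"
    using assms by (intro card_Un_disjoint) (auto simp: unwritten_def)
  then show ?thesis using assms by (auto simp: unwritten_def)
qed

text \<open>
  The price of comparing states only by their size is one run: it empties the buffer, and what
  remains is a final segment of the input, no longer than the unread part of the larger state.
\<close>

lemma rest_subset_of_card_le:
  assumes U: "unwritten M N B r U" and V: "unwritten M N C q V" and "card U \<le> card V"
  shows "rest M I d U \<subseteq> V"
proof -
  have "rest M I d U \<subseteq> U - B"
    using rest_buffer[of M I d U] unwritten_buffer[OF U] by simp
  also have "\<dots> \<subseteq> {r..<N}" using U by (auto simp: unwritten_def)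
  also have "\<dots> \<subseteq> {q..<N}"
  proof (cases "r < N")
    case True
    \<comment> \<open>Here \<open>B\<close> is full and so at least as large as \<open>C\<close>; by
      \<open>unwritten_card\<close>, the state with more unwritten positions cannot have read
      further.\<close>
    then have "q \<le> r" using unwritten_card[OF U] unwritten_card[OF V] assms
      by (auto simp: unwritten_def)
    then show ?thesis by auto
  qed auto
  also have "\<dots> \<subseteq> V" using V by (auto simp: unwritten_def)
  finally show ?thesis .
qed

section \<open>Runs of an output and their directions\<close>

lemma is_run_key_le: "is_run (map ((!) I) X) \<longleftrightarrow> (\<exists>d. sorted_wrt (key_le I d) X)"
proof -
  have "key_le I True = (\<lambda>p q. I ! p \<le> I ! q)" "key_le I False = (\<lambda>p q. I ! q \<le> I ! p)"
    by (auto simp: key_le_def fun_eq_iff)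
  then have "is_run (map ((!) I) X) \<longleftrightarrow> sorted_wrt (key_le I True) X \<or> sorted_wrt (key_le I False) X"
    by (simp add: is_run_def sorted_map sorted_wrt_rev sorted_wrt_map flip: rev_map)
  then show ?thesis by (metis (full_types))
qed

lemma R_le_length:
  assumes "\<forall>X\<in>set Xs. \<exists>d. sorted_wrt (key_le I d) X"
  shows "R (written I (concat Xs)) \<le> length Xs"
  unfolding R_def
proof (rule Least_le, intro exI conjI ballI)
  show "length (map (written I) Xs) = length Xs" by simp
  show "concat (map (written I) Xs) = written I (concat Xs)"
    by (induction Xs) (auto simp: written_def)
  fix x assume "x \<in> set (map (written I) Xs)"
  then obtain X d where "x = written I X" "sorted_wrt (key_le I d) X" using assms by auto
  then show "is_run x"
    unfolding written_def using is_run_key_le by blast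
qed

text \<open>The values of an optimal output are cut into runs, the cuts are lifted to the list of
  positions, and only the direction of each piece is kept. By \<open>rests_writable\<close>, maximal
  runs in these directions also write everything.\<close>

lemma OPT_directions:
  assumes "1 \<le> M"
  shows "\<exists>ds. length ds = OPT M I \<and> rests M I ds {..<length I} = {}"
proof -
  obtain ps where ps: "strategy M (length I) ps" "R (written I ps) = OPT M I"
    using OPT_attained[OF assms] by blast
  obtain rs where rs: "length rs = OPT M I" "concat rs = written I ps" "\<forall>r\<in>set rs. is_run r"
    using R_decomposition[of "written I ps"] ps(2) by metis
  have "\<exists>Xs. concat Xs = ps \<and> length Xs = length rs \<and> (\<forall>X\<in>set Xs. is_run (map ((!) I) X))"
    using rs(2,3) unfolding written_def
  proof (induction rs arbitrary: ps)
    case (Cons r rs)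
    then obtain X ps' where X: "ps = X @ ps'" "map ((!) I) X = r" "map ((!) I) ps' = concat rs"
      by (force simp: append_eq_map_conv)
    then obtain Xs where "concat Xs = ps'" "length Xs = length rs" "\<forall>X\<in>set Xs. is_run (map ((!) I) X)"
      using Cons by (metis list.set_intros(2))
    then show ?case using X Cons.prems by (intro exI[of _ "X # Xs"]) auto
  qed simp
  then obtain Xs where Xs: "concat Xs = ps" "length Xs = OPT M I" "\<forall>X\<in>set Xs. is_run (map ((!) I) X)"
    using rs(1) by auto
  then have "\<forall>X\<in>set Xs. \<exists>d. sorted_wrt (key_le I d) X"
    using is_run_key_le by blast
  then obtain dir where "\<And>X. X \<in> set Xs \<Longrightarrow> sorted_wrt (key_le I (dir X)) X" by metis
  then have "list_all2 (\<lambda>d X. sorted_wrt (key_le I d) X) (map dir Xs) Xs"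
    by (auto simp: list_all2_conv_all_nth)
  then have "rests M I (map dir Xs) {..<length I} \<subseteq> {..<length I} - set (concat Xs)"
    using ps(1) Xs(1) by (intro rests_writable) (auto simp: strategy_writable)
  then show ?thesis using ps(1) Xs by (intro exI[of _ "map dir Xs"]) (auto simp: strategy_writable)
qed


section \<open>Execution with step counts\<close>

text \<open>The existential includes termination, and since \<open>exec\<close> is deterministic it
  speaks about the only possible execution. Passing the step count to the postcondition lets costs
  and values be proved together.\<close>

definition wp :: "'a::linorder list \<Rightarrow> com \<Rightarrow> (nat \<Rightarrow> state \<Rightarrow> bool) \<Rightarrow> state \<Rightarrow> bool" where
  "wp I c Q s \<longleftrightarrow> (\<exists>t s'. exec I c s t s' \<and> Q t s')"

lemma wp_mono: "wp I c P s \<Longrightarrow> (\<And>t s'. P t s' \<Longrightarrow> Q t s') \<Longrightarrow> wp I c Q s"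
  by (auto simp: wp_def)

inductive_simps exec_simps:
  "exec I Skip s t s'"
  "exec I (Assign x a) s t s'"
  "exec I (Store a b) s t s'"
  "exec I (Emit a) s t s'"
  "exec I (Seq c d) s t s'"
  "exec I (If e c d) s t s'"

lemma wp_simps:
  "wp I Skip Q s \<longleftrightarrow> Q 1 s"
  "wp I (Assign x a) Q s \<longleftrightarrow> Q (1 + acost a) (s\<lparr>reg := (reg s)(x := aval a s)\<rparr>)"
  "wp I (Store a b) Q s \<longleftrightarrow> Q (1 + acost a + acost b) (s\<lparr>mem := (mem s)(aval a s := aval b s)\<rparr>)"
  "wp I (Emit a) Q s \<longleftrightarrow> Q (1 + acost a) (s\<lparr>emitted := emitted s @ [aval a s]\<rparr>)"
  "wp I (Seq c d) Q s \<longleftrightarrow> wp I c (\<lambda>t s'. wp I d (\<lambda>t'. Q (1 + t + t')) s') s"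
  "wp I (If e c d) Q s \<longleftrightarrow> wp I (if bval I e s then c else d) (\<lambda>t. Q (1 + bcost e + t)) s"
  unfolding wp_def exec_simps by (force+)

lemma wp_While_unfold:
  assumes "bval I b s \<Longrightarrow>
      wp I c (\<lambda>t s'. wp I (While b c) (\<lambda>t' s''. Q (1 + bcost b + t + t') s'') s') s"
    and "\<not> bval I b s \<Longrightarrow> Q (1 + bcost b) s"
  shows "wp I (While b c) Q s"
  using assms unfolding wp_def by (cases "bval I b s") (blast intro: exec.intros)+

text \<open>\<open>T\<close> is at once the time budget and the termination measure: each pass
  spends at least one step, so \<open>T\<close> strictly decreases.\<close>

lemma wp_While:
  assumes "P s"
    and body: "\<And>s. P s \<Longrightarrow> bval I b s \<Longrightarrow> wp I c (\<lambda>t s'. P s' \<and> 1 + bcost b + t + T s' \<le> T s) s"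
    and exit: "\<And>s. P s \<Longrightarrow> \<not> bval I b s \<Longrightarrow> 1 + bcost b \<le> T s"
  shows "wp I (While b c) (\<lambda>t s'. P s' \<and> \<not> bval I b s' \<and> t \<le> T s) s"
  using assms(1)
proof (induction "T s" arbitrary: s rule: less_induct)
  case less
  show ?case
  proof (rule wp_While_unfold)
    assume "bval I b s"
    from body[OF less.prems this] show "wp I c (\<lambda>t s'. wp I (While b c)
      (\<lambda>t' s''. P s'' \<and> \<not> bval I b s'' \<and> 1 + bcost b + t + t' \<le> T s) s') s"
    proof (rule wp_mono)
      fix t s' assume s': "P s' \<and> 1 + bcost b + t + T s' \<le> T s"
      then show "wp I (While b c)
        (\<lambda>t' s''. P s'' \<and> \<not> bval I b s'' \<and> 1 + bcost b + t + t' \<le> T s) s'"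
        by (intro wp_mono[OF less.hyps]) auto
    qed
  qed (use less.prems exit in auto)
qed

definition keeps :: "string set \<Rightarrow> state \<Rightarrow> state \<Rightarrow> bool" where
  "keeps X s s' \<longleftrightarrow> (\<forall>x. x \<notin> X \<longrightarrow> reg s' x = reg s x)"

lemma keeps_trans: "keeps X s s' \<Longrightarrow> keeps Y s' s'' \<Longrightarrow> X \<subseteq> Z \<Longrightarrow> Y \<subseteq> Z \<Longrightarrow> keeps Z s s''"
  unfolding keeps_def by (metis subsetD)

lemma keepsD: "keeps X s s' \<Longrightarrow> x \<notin> X \<Longrightarrow> reg s' x = reg s x"
  by (simp add: keeps_def)

text \<open>The direction is a parameter of program generation, not a register: code for each
  direction is generated separately.\<close>

definition key_less_eq :: "bool \<Rightarrow> aexp \<Rightarrow> aexp \<Rightarrow> bexp" where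
  "key_less_eq d a b = (if d then KeyLe a b else KeyLe b a)"

lemma bval_key_less_eq:
  "aval a s < length I \<Longrightarrow> aval b s < length I \<Longrightarrow>
    bval I (key_less_eq d a b) s \<longleftrightarrow> key_le I d (aval a s) (aval b s)"
  by (auto simp: key_less_eq_def key_le_def)

lemma bcost_key_less_eq [simp]: "bcost (key_less_eq d a b) = 1 + acost a + acost b"
  by (auto simp: key_less_eq_def)

section \<open>Heaps\<close>

text \<open>The machine cannot halve an index, so heaps are only ever repaired downwards.\<close>

definition heap :: "'a::linorder list \<Rightarrow> bool \<Rightarrow> nat \<Rightarrow> nat \<Rightarrow> (nat \<Rightarrow> nat) \<Rightarrow> bool" where
  "heap I d lo h f \<longleftrightarrow> (\<forall>j\<le>h. lo \<le> j div 2 \<longrightarrow> key_le I d (f (j div 2)) (f j))"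

text \<open>Heap order except between \<open>i\<close> and its children, which still lie below the parent of \<open>i\<close>.\<close>

definition heap_hole :: "'a::linorder list \<Rightarrow> bool \<Rightarrow> nat \<Rightarrow> nat \<Rightarrow> (nat \<Rightarrow> nat) \<Rightarrow> nat \<Rightarrow> bool" where
  "heap_hole I d lo h f i \<longleftrightarrow>
    (\<forall>j\<le>h. lo \<le> j div 2 \<longrightarrow> j div 2 \<noteq> i \<longrightarrow> key_le I d (f (j div 2)) (f j)) \<and>
    (\<forall>j\<le>h. j div 2 = i \<longrightarrow> lo \<le> i div 2 \<longrightarrow> key_le I d (f (i div 2)) (f j))"

lemma heap_min:
  assumes "heap I d 1 h f" "1 \<le> x" "x \<le> h"
  shows "key_le I d (f 1) (f x)"
  using assms(2,3)
proof (induction x rule: less_induct)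
  case (less x)
  show ?case
  proof (cases "x = 1")
    case False
    then have "1 \<le> x div 2" "x div 2 < x" using less.prems by auto
    then have "key_le I d (f 1) (f (x div 2))" "key_le I d (f (x div 2)) (f x)"
      using less assms(1) by (auto simp: heap_def)
    then show ?thesis by (rule key_le_trans)
  qed simp
qed

lemma heap_hole_leaf: "heap_hole I d lo h f i \<Longrightarrow> h < 2 * i \<Longrightarrow> heap I d lo h f"
  unfolding heap_def heap_hole_def by auto

lemma heap_hole_closed:
  assumes "heap_hole I d lo h f i" "key_le I d (f i) (f j)"
    "\<And>c. c \<le> h \<Longrightarrow> c div 2 = i \<Longrightarrow> key_le I d (f j) (f c)"
  shows "heap I d lo h f"
  unfolding heap_def
proof (intro allI impI)
  fix c assume "c \<le> h" "lo \<le> c div 2"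
  then show "key_le I d (f (c div 2)) (f c)"
    using assms key_le_trans[OF assms(2)] by (cases "c div 2 = i") (auto simp: heap_hole_def)
qed

text \<open>The smallest child \<open>j\<close> moves up. It precedes its sibling by
  \<open>child\<close>, and it follows the parent of \<open>i\<close> by the second clause of
  \<open>heap_hole\<close>. The children of \<open>j\<close> follow the old \<open>f j\<close>,
  which now sits in their grandparent \<open>i\<close>; this restores the second clause at
  \<open>j\<close>.\<close>

lemma heap_hole_swap:
  assumes hole: "heap_hole I d lo h f i" and "1 \<le> lo" "1 \<le> i"
    and j: "j \<le> h" "j div 2 = i" and le: "\<not> key_le I d (f i) (f j)"
    and child: "\<And>c. c \<le> h \<Longrightarrow> c div 2 = i \<Longrightarrow> key_le I d (f j) (f c)"
  shows "heap_hole I d lo h (f(i := f j, j := f i)) j"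
proof -
  have ij: "i < j" "i div 2 < i" using j(2) \<open>1 \<le> i\<close> by auto
  let ?f = "f(i := f j, j := f i)"
  have "key_le I d (?f (c div 2)) (?f c)" if c: "c \<le> h" "lo \<le> c div 2" "c div 2 \<noteq> j" for c
  proof -
    consider "c = j" | "c \<noteq> j" "c div 2 = i" | "c = i" | "c \<noteq> i" "c \<noteq> j" "c div 2 \<noteq> i" by blast
    then show ?thesis
    proof cases
      case 1
      then show ?thesis using j ij key_le_total[OF le] by auto
    next
      case 2
      moreover from this have "c \<noteq> i" using ij by auto
      ultimately show ?thesis using c child ij by auto
    next
      case 3
      then show ?thesis using hole c j ij by (auto simp: heap_hole_def)
    next
      case 4
      then show ?thesis using hole c by (auto simp: heap_hole_def)
    qed
  qed
  moreover have "key_le I d (?f (j div 2)) (?f c)" if c: "c \<le> h" "c div 2 = j" "lo \<le> j div 2" for c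
  proof -
    have "c \<noteq> j" "c \<noteq> i" using c ij by auto
    then show ?thesis using hole c j ij by (auto simp: heap_hole_def)
  qed
  ultimately show ?thesis by (auto simp: heap_hole_def)
qed

text \<open>Lowering the bound from \<open>Suc i\<close> to \<open>i\<close> adds only the
  comparisons of \<open>i\<close> with its children; the clause about the parent of \<open>i\<close>
  is vacuous because \<open>i div 2 < i\<close>.\<close>

lemma heap_hole_start: "heap I d (Suc i) h f \<Longrightarrow> 1 \<le> i \<Longrightarrow> heap_hole I d i h f i"
  unfolding heap_def heap_hole_def by auto

section \<open>Permuting memory cells\<close>

text \<open>A permutation, not mere equality of images: it also preserves injectivity and fixes the
  cells beyond \<open>h\<close>.\<close>

definition rearranged :: "nat \<Rightarrow> (nat \<Rightarrow> nat) \<Rightarrow> (nat \<Rightarrow> nat) \<Rightarrow> bool" where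
  "rearranged h f g \<longleftrightarrow> (\<exists>\<pi>. \<pi> permutes {1..h} \<and> g = f \<circ> \<pi>)"

lemma rearranged_refl [simp]: "rearranged h f f"
  unfolding rearranged_def by (rule exI[of _ id]) (simp add: permutes_id)

lemma rearranged_trans: "rearranged h f g \<Longrightarrow> rearranged h g k \<Longrightarrow> rearranged h f k"
  unfolding rearranged_def using permutes_compose comp_assoc by metis

lemma rearranged_swap:
  assumes "1 \<le> i" "i \<le> h" "1 \<le> j" "j \<le> h"
  shows "rearranged h f (f(i := f j, j := f i))"
  unfolding rearranged_def
proof (intro exI conjI)
  show "transpose i j permutes {1..h}" using assms by (intro permutes_swap_id) auto
  show "f(i := f j, j := f i) = f \<circ> transpose i j" by (auto simp: fun_eq_iff transpose_def)
qed

lemma rearranged_mono: "rearranged h f g \<Longrightarrow> h \<le> m \<Longrightarrow> rearranged m f g"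
  unfolding rearranged_def using permutes_subset[of _ "{1..h}" "{1..m}"] by auto

lemma rearranged_image: "rearranged m f g \<Longrightarrow> g ` {1..m} = f ` {1..m}"
  unfolding rearranged_def by (elim exE conjE) (simp only: image_comp[symmetric] permutes_image)

lemma rearranged_inj: "rearranged m f g \<Longrightarrow> inj_on f {1..m} \<Longrightarrow> inj_on g {1..m}"
  unfolding rearranged_def
  by (elim exE conjE) (simp only: permutes_image permutes_inj_on comp_inj_on)

lemma rearranged_outside: "rearranged h f g \<Longrightarrow> h < x \<Longrightarrow> g x = f x"
  unfolding rearranged_def by (auto simp: permutes_not_in)

lemma rearranged_ball:
  assumes "rearranged h f g" "\<And>x. 1 \<le> x \<Longrightarrow> x \<le> h \<Longrightarrow> P (f x)" "1 \<le> x" "x \<le> h"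
  shows "P (g x)"
proof -
  have "g x \<in> f ` {1..h}" using rearranged_image[OF assms(1)] assms(3,4) by auto
  then show ?thesis using assms(2) by auto
qed

section \<open>Sifting down\<close>

text \<open>Setting \<open>i\<close> to \<open>h + 1\<close> makes the loop of \<open>sift\<close> stop.\<close>

definition sift_step :: "bool \<Rightarrow> com" where
  "sift_step d =
    Seq (Assign ''j'' (Add (Var ''i'') (Var ''i'')))
    (Seq (If (Conj (Less (Var ''j'') (Var ''h''))
               (Neg (key_less_eq d (Load (Var ''j'')) (Load (Add (Var ''j'') (Const 1))))))
           (Assign ''j'' (Add (Var ''j'') (Const 1))) Skip)
    (If (key_less_eq d (Load (Var ''i'')) (Load (Var ''j'')))
      (Assign ''i'' (Add (Var ''h'') (Const 1)))
      (Seq (Assign ''x'' (Load (Var ''i'')))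
      (Seq (Store (Var ''i'') (Load (Var ''j'')))
      (Seq (Store (Var ''j'') (Var ''x''))
      (Assign ''i'' (Var ''j'')))))))"

definition sift :: "bool \<Rightarrow> com" where
  "sift d = While (Neg (Less (Var ''h'') (Add (Var ''i'') (Var ''i'')))) (sift_step d)"

lemma wp_sift_step:
  assumes s: "reg s ''i'' = i" "reg s ''h'' = h" "mem s = f"
    and i: "1 \<le> i" "2 * i \<le> h"
    and ran: "\<And>x. 1 \<le> x \<Longrightarrow> x \<le> h \<Longrightarrow> f x < length I"
    and hole: "heap_hole I d lo h f i" "1 \<le> lo"
  shows "wp I (sift_step d) (\<lambda>t s'. t \<le> 50 \<and> keeps {''i'', ''j'', ''x''} s s' \<and> emitted s' = emitted s \<and>
    2 * i \<le> reg s' ''i'' \<and> heap_hole I d lo h (mem s') (reg s' ''i'') \<and>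
    rearranged h f (mem s')) s"
proof -
  define j where "j = (if 2 * i < h \<and> \<not> key_le I d (f (2 * i)) (f (Suc (2 * i))) then Suc (2 * i) else 2 * i)"
  have j: "j \<le> h" "j div 2 = i" "2 * i \<le> j" "1 \<le> j" using i by (auto simp: j_def)
  have child: "key_le I d (f j) (f c)" if "c \<le> h" "c div 2 = i" for c
  proof -
    have "c = 2 * i \<or> c = Suc (2 * i)" using that by auto
    then show ?thesis
      using that key_le_total[of I d "f (2 * i)" "f (Suc (2 * i))"] by (auto simp: j_def)
  qed
  have "rearranged h f (f(i := f j, j := f i))"
    using i j(1,4) by (intro rearranged_swap) auto
  \<comment> \<open>No cell up to \<open>h\<close> has \<open>Suc h\<close> as its parent, so a hole
    there excuses nothing.\<close>
  moreover have "heap_hole I d lo h f (Suc h)" if "key_le I d (f i) (f j)"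
    using heap_hole_closed[OF hole(1) that child] hole(2) by (auto simp: heap_hole_def heap_def)
  moreover have "heap_hole I d lo h (f(i := f j, j := f i)) j" if "\<not> key_le I d (f i) (f j)"
    using heap_hole_swap[OF hole i(1) j(1,2) that child] .
  moreover have "i \<noteq> j" "Suc (2 * i) \<le> h \<longleftrightarrow> 2 * i < h" using i j by auto
  moreover have "f i < length I" "f j < length I" "f (2 * i) < length I" "2 * i < h \<Longrightarrow> f (Suc (2 * i)) < length I"
    using i j by (auto intro!: ran)
  ultimately show ?thesis
    using s i j(3) unfolding sift_step_def
    by (cases "2 * i < h"; cases "key_le I d (f (2 * i)) (f (Suc (2 * i)))"; cases "key_le I d (f i) (f j)";
      simp add: wp_simps bval_key_less_eq keeps_def mult_2[symmetric] j_def)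
qed

text \<open>\<open>n\<close> bounds the levels below \<open>i\<close>: every step at least doubles
  \<open>i\<close>, and the loop ends once \<open>2 * i\<close> exceeds \<open>h\<close>.\<close>

lemma wp_sift:
  assumes s: "reg s ''i'' = i" "reg s ''h'' = h"
    and i: "1 \<le> i" "h < i * 2 ^ n"
    and ran: "\<And>x. 1 \<le> x \<Longrightarrow> x \<le> h \<Longrightarrow> mem s x < length I"
    and hole: "heap_hole I d lo h (mem s) i" "1 \<le> lo"
  shows "wp I (sift d) (\<lambda>t s'. t \<le> 60 * n + 10 \<and> keeps {''i'', ''j'', ''x''} s s' \<and> emitted s' = emitted s \<and>
    heap I d lo h (mem s') \<and> rearranged h (mem s) (mem s')) s"
  using s i ran hole(1)
proof (induction n arbitrary: s i)
  case 0
  then have "heap I d lo h (mem s)" by (intro heap_hole_leaf) auto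
  then show ?case
    using 0 unfolding sift_def by (intro wp_While_unfold) (auto simp: keeps_def)
next
  case (Suc n)
  show ?case
  proof (cases "h < 2 * i")
    case True
    then have "heap I d lo h (mem s)" by (intro heap_hole_leaf[OF Suc.prems(6)])
    then show ?thesis
      using Suc.prems True unfolding sift_def by (intro wp_While_unfold) (auto simp: keeps_def)
  next
    case False
    let ?b = "Neg (Less (Var ''h'') (Add (Var ''i'') (Var ''i'')))"
    have "wp I (sift_step d) (\<lambda>t s'. wp I (sift d) (\<lambda>t' s''. 1 + bcost ?b + t + t' \<le> 60 * Suc n + 10 \<and>
      keeps {''i'', ''j'', ''x''} s s'' \<and> emitted s'' = emitted s \<and>
      heap I d lo h (mem s'') \<and> rearranged h (mem s) (mem s'')) s') s"
      (is "wp _ _ (\<lambda>t s'. wp _ _ (?Q t) s') s")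
    proof (rule wp_mono[OF wp_sift_step[where lo=lo, OF Suc.prems(1,2) refl Suc.prems(3) _ Suc.prems(5,6) hole(2)]])
      fix t :: nat and s'
      assume "t \<le> 50 \<and> keeps {''i'', ''j'', ''x''} s s' \<and> emitted s' = emitted s \<and>
        2 * i \<le> reg s' ''i'' \<and> heap_hole I d lo h (mem s') (reg s' ''i'') \<and>
        rearranged h (mem s) (mem s')"
      then have s': "t \<le> 50" "keeps {''i'', ''j'', ''x''} s s'" "emitted s' = emitted s"
        "2 * i \<le> reg s' ''i''" "heap_hole I d lo h (mem s') (reg s' ''i'')"
        "rearranged h (mem s) (mem s')" by auto
      have "h < reg s' ''i'' * 2 ^ n"
      proof -
        have "h < 2 * i * 2 ^ n" using Suc.prems(4) by (simp add: mult_ac)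
        also have "\<dots> \<le> reg s' ''i'' * 2 ^ n" using s'(4) by (rule mult_right_mono) simp
        finally show ?thesis .
      qed
      moreover have "mem s' x < length I" if "1 \<le> x" "x \<le> h" for x
        using rearranged_ball[OF s'(6), of "\<lambda>y. y < length I"] Suc.prems(5) that by blast
      moreover have "reg s' ''h'' = h" using keepsD[OF s'(2)] Suc.prems(2) by simp
      moreover have "1 \<le> reg s' ''i''" using s'(4) Suc.prems(3) by simp
      ultimately have "wp I (sift d) (\<lambda>t s''. t \<le> 60 * n + 10 \<and> keeps {''i'', ''j'', ''x''} s' s'' \<and>
        emitted s'' = emitted s' \<and> heap I d lo h (mem s'') \<and>
        rearranged h (mem s') (mem s'')) s'"
        using s'(5) by (intro Suc.IH[OF refl]) auto
      then show "wp I (sift d) (?Q t) s'"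
      proof (rule wp_mono)
        fix u :: nat and s''
        assume "u \<le> 60 * n + 10 \<and> keeps {''i'', ''j'', ''x''} s' s'' \<and>
          emitted s'' = emitted s' \<and> heap I d lo h (mem s'') \<and>
          rearranged h (mem s') (mem s'')"
        then have s'': "u \<le> 60 * n + 10" "keeps {''i'', ''j'', ''x''} s' s''"
          "emitted s'' = emitted s'" "heap I d lo h (mem s'')"
          "rearranged h (mem s') (mem s'')" by auto
        show "?Q t u s''"
          using s'(1,3) s''(1-4) keeps_trans[OF s'(2) s''(2) order_refl order_refl]
            rearranged_trans[OF s'(6) s''(5)] by auto
      qed
    qed (use False in simp)
    then show ?thesis
      using Suc.prems(1,2) False unfolding sift_def by (intro wp_While_unfold) auto
  qed
qed

section \<open>Replacement selection\<close>

definition layout :: "nat \<Rightarrow> nat \<Rightarrow> (nat \<Rightarrow> nat) \<Rightarrow> nat \<Rightarrow> nat \<Rightarrow> nat set \<Rightarrow> bool" where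
  "layout M N f m r U \<longleftrightarrow> inj_on f {1..m} \<and> unwritten M N (f ` {1..m}) r U"

lemma layout_facts:
  assumes "layout M N f m r U"
  shows "buffer M U = f ` {1..m}" "card U + r = m + N" "finite U" "r \<le> N" "m \<le> r" "m \<le> M"
    "r < N \<Longrightarrow> m = M" "1 \<le> x \<Longrightarrow> x \<le> m \<Longrightarrow> f x < r" "r \<notin> f ` {1..m}"
proof -
  have u: "unwritten M N (f ` {1..m}) r U" and c: "card (f ` {1..m}) = m"
    using assms by (auto simp: layout_def card_image)
  show "buffer M U = f ` {1..m}" "card U + r = m + N" "finite U"
    using unwritten_buffer[OF u] unwritten_card[OF u] unwritten_finite[OF u] c by auto
  show "r \<le> N" "m \<le> M" "r < N \<Longrightarrow> m = M" "1 \<le> x \<Longrightarrow> x \<le> m \<Longrightarrow> f x < r" "r \<notin> f ` {1..m}"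
    using u c by (auto simp: unwritten_def image_subset_iff)
  have "card (f ` {1..m}) \<le> card {..<r}" using u by (intro card_mono) (auto simp: unwritten_def)
  then show "m \<le> r" using c by simp
qed

lemma layout_cong:
  "layout M N f m r U \<Longrightarrow> (\<And>x. 1 \<le> x \<Longrightarrow> x \<le> m \<Longrightarrow> g x = f x) \<Longrightarrow> layout M N g m r U"
  using inj_on_cong[of "{1..m}" g f] image_cong[of "{1..m}" "{1..m}" g f] unfolding layout_def by simp

lemma layout_rearranged: "layout M N f m r U \<Longrightarrow> rearranged m f g \<Longrightarrow> layout M N g m r U"
  unfolding layout_def using rearranged_inj rearranged_image by metis

lemma layout_overwrite:
  assumes "layout M N f m r U" "1 \<le> h" "h \<le> m" "r < N"
  shows "layout M N (f(h := r)) m (Suc r) (U - {f h})"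
proof -
  have inj: "inj_on f {1..m}" and u: "unwritten M N (f ` {1..m}) r U"
    using assms by (auto simp: layout_def)
  have "(f(h := r)) ` {1..m} = insert r (f ` ({1..m} - {h}))" using assms by auto
  also have "f ` ({1..m} - {h}) = f ` {1..m} - {f h}"
    using inj assms by (subst inj_on_image_set_diff[of f "{1..m}"]) auto
  finally have "(f(h := r)) ` {1..m} = insert r (f ` {1..m} - {f h})" .
  moreover have "inj_on (f(h := r)) {1..m}"
    using inj layout_facts(9)[OF assms(1)] by (rule inj_on_fun_updI)
  ultimately show ?thesis
    using unwritten_step[OF u, of "f h"] assms by (auto simp: layout_def)
qed

lemma layout_pop_last:
  assumes "layout M N f m N U" "1 \<le> m"
  shows "layout M N f (m - 1) N (U - {f m})"
proof -
  have inj: "inj_on f {1..m}" and u: "unwritten M N (f ` {1..m}) N U"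
    using assms by (auto simp: layout_def)
  have "{1..m - 1} = {1..m} - {m}" using assms by auto
  also have "f ` ({1..m} - {m}) = f ` {1..m} - {f m}"
    using inj assms by (subst inj_on_image_set_diff[of f "{1..m}"]) auto
  finally have "f ` {1..m - 1} = f ` {1..m} - {f m}" .
  moreover have "inj_on f {1..m - 1}" using inj by (rule inj_on_subset) auto
  ultimately show ?thesis
    using unwritten_step[OF u, of "f m"] assms by (auto simp: layout_def)
qed

text \<open>Seen as a swap of cells \<open>1\<close> and \<open>h\<close>, after which the incoming
  position overwrites the written one in cell \<open>h\<close>.\<close>

lemma layout_replace:
  assumes "layout M N f m r U" "1 \<le> h" "h \<le> m" "r < N"
  shows "layout M N (f(1 := f h, h := r)) m (Suc r) (U - {f 1})"
proof -
  let ?g = "f(1 := f h, h := f 1)"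
  have "layout M N ?g m r U"
    using assms by (intro layout_rearranged[OF assms(1)] rearranged_swap) auto
  from layout_overwrite[OF this assms(2-4)] show ?thesis by simp
qed

text \<open>Two swaps carry the written position from cell \<open>1\<close> through \<open>h\<close>
  to \<open>m\<close>, where it is cut off. The stated function differs from this permutation at
  most in cell \<open>m\<close>, no longer part of the buffer.\<close>

lemma layout_pop:
  assumes "layout M N f m N U" "1 \<le> h" "h \<le> m"
  shows "layout M N (f(1 := f h, h := f m)) (m - 1) N (U - {f 1})"
proof -
  define g where "g = f(1 := f h, h := f 1)"
  define k where "k = g(h := g m, m := g h)"
  have "rearranged m f g" unfolding g_def using assms by (intro rearranged_swap) auto
  moreover have "rearranged m g k" unfolding k_def using assms by (intro rearranged_swap) auto
  ultimately have "layout M N k m N U" using assms layout_rearranged by blast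
  then have "layout M N k (m - 1) N (U - {k m})" using assms by (intro layout_pop_last) auto
  moreover have "k m = f 1" by (simp add: k_def g_def)
  moreover have "(f(1 := f h, h := f m)) x = k x" if "1 \<le> x" "x \<le> m - 1" for x
    using that assms by (auto simp: k_def g_def)
  ultimately show ?thesis using layout_cong by metis
qed

section \<open>The invariant of a run in progress\<close>

text \<open>
  During a run the cells \<open>1, \<dots>, h\<close> hold the positions that can still join the run \<open>xs\<close>; those in
  \<open>h + 1, \<dots>, m\<close> must wait for the next run.
\<close>

definition piles :: "nat \<Rightarrow> 'a::linorder list \<Rightarrow> bool \<Rightarrow> nat set \<Rightarrow> nat list \<Rightarrow>
    (nat \<Rightarrow> nat) \<Rightarrow> nat \<Rightarrow> nat \<Rightarrow> nat \<Rightarrow> bool" where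
  "piles M I d U xs f m r h \<longleftrightarrow> layout M (length I) f m r (U - set xs) \<and> h \<le> m \<and> greedy M I d U xs \<and>
    (\<forall>x\<in>{1..h}. \<forall>y\<in>set xs. key_le I d y (f x)) \<and>
    (\<forall>x\<in>{h<..m}. \<exists>y\<in>set xs. \<not> key_le I d y (f x))"

lemma piles_rearranged:
  assumes "piles M I d U xs f m r h" "rearranged h f g"
  shows "piles M I d U xs g m r h"
proof -
  have "rearranged m f g" using assms by (auto simp: piles_def intro: rearranged_mono)
  then have "layout M (length I) g m r (U - set xs)"
    using assms layout_rearranged unfolding piles_def by blast
  moreover have "\<forall>y\<in>set xs. key_le I d y (g x)" if "x \<in> {1..h}" for x
    using rearranged_ball[OF assms(2), of "\<lambda>z. \<forall>y\<in>set xs. key_le I d y z" x] assms(1) that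
    by (auto simp: piles_def)
  ultimately show ?thesis
    using assms rearranged_outside[OF assms(2)] by (auto simp: piles_def)
qed

text \<open>Waiting positions are no candidates, so the candidates are exactly the heap cells, and
  the root precedes them all.\<close>

lemma piles_greedy:
  assumes p: "piles M I d U xs f m r h" and "heap I d 1 h f" "1 \<le> h"
  shows "greedy M I d U (xs @ [f 1])"
proof -
  have h: "h \<le> m" and g: "greedy M I d U xs" and b: "buffer M (U - set xs) = f ` {1..m}"
    and up: "\<forall>x\<in>{1..h}. \<forall>y\<in>set xs. key_le I d y (f x)"
    and down: "\<forall>x\<in>{h<..m}. \<exists>y\<in>set xs. \<not> key_le I d y (f x)"
    using p layout_facts(1) by (auto simp: piles_def)
  have "key_le I d (f 1) q"
    if q: "q \<in> buffer M (U - set xs)" "\<forall>y\<in>set xs. key_le I d y q" for q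
  proof -
    obtain x where x: "q = f x" "1 \<le> x" "x \<le> m" using q b by auto
    then have "x \<le> h" using q(2) down by force
    then show ?thesis using heap_min[OF assms(2)] x by auto
  qed
  then show ?thesis
    using g b up h \<open>1 \<le> h\<close> by (intro greedy_snoc) auto
qed

text \<open>One statement for the three outcomes of \<open>pop\<close>: the next input joins the
  heap (\<open>h' = h\<close>), it has to wait (\<open>h' = h - 1\<close>, \<open>m' = m\<close>),
  or the input is exhausted (\<open>h' = h - 1\<close>, \<open>m' = m - 1\<close>). Only the root
  and, if the heap shrinks, its former last cell may change.\<close>

lemma piles_step:
  assumes p: "piles M I d U xs f m r h" and hp: "heap I d 1 h f" "1 \<le> h"
    and "layout M (length I) g m' r' (U - set xs - {f 1})" "h' \<le> h" "h' \<le> m'" "m' \<le> m"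
    and same: "\<And>x. 1 < x \<Longrightarrow> x \<le> m' \<Longrightarrow> x \<noteq> h \<or> h' = h \<Longrightarrow> g x = f x"
    and front: "1 \<le> h' \<Longrightarrow> key_le I d (f 1) (g 1)"
    and rear: "h' < h \<Longrightarrow> h \<le> m' \<Longrightarrow> \<exists>y\<in>set (xs @ [f 1]). \<not> key_le I d y (g h)" "h \<le> Suc h'"
  shows "piles M I d U (xs @ [f 1]) g m' r' h' \<and> heap_hole I d 1 h' g 1"
proof -
  have "U - set (xs @ [f 1]) = U - set xs - {f 1}" by auto
  moreover have "key_le I d y (g x)" if "x \<in> {1..h'}" "y \<in> set (xs @ [f 1])" for x y
  proof -
    have "key_le I d (f 1) (g x)"
    proof (cases "x = 1")
      case False
      then have "g x = f x" using that same[of x] assms(5-7) by auto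
      then show ?thesis using heap_min[OF hp(1)] that assms(5) by auto
    qed (use front that in auto)
    moreover have "key_le I d y (f 1)" using that(2) p hp(2) by (auto simp: piles_def)
    ultimately show ?thesis using key_le_trans by blast
  qed
  moreover have "\<exists>y\<in>set (xs @ [f 1]). \<not> key_le I d y (g x)" if "x \<in> {h'<..m'}" for x
  proof (cases "x = h")
    case True
    then show ?thesis using rear(1) that by auto
  next
    case False
    then have "h < x" using that rear(2) by auto
    then have "g x = f x" using that same[of x] hp(2) by auto
    then show ?thesis using p that \<open>h < x\<close> \<open>m' \<le> m\<close> by (auto simp: piles_def)
  qed
  ultimately have "piles M I d U (xs @ [f 1]) g m' r' h'"
    using piles_greedy[OF p hp] assms(4,6) by (simp add: piles_def)
  moreover have "key_le I d (g (j div 2)) (g j)" if "j \<le> h'" "1 \<le> j div 2" "j div 2 \<noteq> 1" for j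
  proof -
    have "1 < j div 2" "j div 2 < j" using that by auto
    moreover from this have "g j = f j" "g (j div 2) = f (j div 2)"
      using that assms(5,6) by (auto intro!: same)
    ultimately show ?thesis using hp(1) that assms(5) by (auto simp: heap_def)
  qed
  ultimately show ?thesis by (auto simp: heap_hole_def)
qed

text \<open>\<open>e\<close> separates committed runs from simulated ones: an \<open>Emit\<close>
  cannot be taken back, so simulations are generated without it.\<close>

definition pop :: "bool \<Rightarrow> bool \<Rightarrow> com" where
  "pop e d =
    Seq (Assign ''p'' (Load (Const 1)))
    (Seq (if e then Emit (Var ''p'') else Skip)
    (Seq (Assign ''i'' (Const 1))
    (If (Less (Var ''r'') (Var ''N''))
      (Seq (If (key_less_eq d (Var ''p'') (Var ''r''))
              (Store (Const 1) (Var ''r''))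
              (Seq (Store (Const 1) (Load (Var ''h'')))
              (Seq (Store (Var ''h'') (Var ''r''))
              (Assign ''h'' (Sub (Var ''h'') (Const 1))))))
           (Assign ''r'' (Add (Var ''r'') (Const 1))))
      (Seq (Store (Const 1) (Load (Var ''h'')))
      (Seq (Store (Var ''h'') (Load (Var ''m'')))
      (Seq (Assign ''m'' (Sub (Var ''m'') (Const 1)))
      (Assign ''h'' (Sub (Var ''h'') (Const 1)))))))))"

definition emits :: "bool \<Rightarrow> nat list \<Rightarrow> nat list" where
  "emits e xs = (if e then xs else [])"

lemma emits_append: "emits e (xs @ ys) = emits e xs @ emits e ys"
  by (simp add: emits_def)

abbreviation "work_regs \<equiv> {''p'', ''m'', ''h'', ''r'', ''i'', ''j'', ''x'', ''q''}"

text \<open>The cells above \<open>N\<close> are reserved for the saved copy of the buffer, which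
  has to survive the simulations.\<close>

definition frame :: "nat \<Rightarrow> state \<Rightarrow> state \<Rightarrow> bool" where
  "frame N s s' \<longleftrightarrow> keeps work_regs s s' \<and> (\<forall>x>N. mem s' x = mem s x)"

lemma frame_refl [simp]: "frame N s s"
  by (simp add: frame_def keeps_def)

lemma frame_trans: "frame N s s' \<Longrightarrow> frame N s' s'' \<Longrightarrow> frame N s s''"
  unfolding frame_def keeps_def by simp

definition piles_state :: "nat \<Rightarrow> 'a::linorder list \<Rightarrow> bool \<Rightarrow> nat set \<Rightarrow> nat list \<Rightarrow> state \<Rightarrow> bool" where
  "piles_state M I d U xs s \<longleftrightarrow> reg s ''N'' = length I \<and>
    piles M I d U xs (mem s) (reg s ''m'') (reg s ''r'') (reg s ''h'')"

lemma wp_pop: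
  assumes p: "piles_state M I d U xs s" and hp: "heap I d 1 (reg s ''h'') (mem s)" and h: "1 \<le> reg s ''h''"
  shows "wp I (pop e d) (\<lambda>t s'. t \<le> 50 \<and> piles_state M I d U (xs @ [mem s 1]) s' \<and>
    heap_hole I d 1 (reg s' ''h'') (mem s') 1 \<and> reg s' ''i'' = 1 \<and> reg s' ''h'' \<le> reg s ''h'' \<and>
    emitted s' = emitted s @ emits e [mem s 1] \<and> frame (length I) s s') s"
proof -
  define f m r h where "f = mem s" and "m = reg s ''m''" and "r = reg s ''r''" and "h = reg s ''h''"
  note defs = f_def[symmetric] m_def[symmetric] r_def[symmetric] h_def[symmetric]
  have p: "piles M I d U xs f m r h" and N: "reg s ''N'' = length I"
    using p by (auto simp: piles_state_def defs)
  have hp: "heap I d 1 h f" "1 \<le> h" using hp h by (auto simp: defs)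
  have l: "layout M (length I) f m r (U - set xs)" and hm: "h \<le> m" using p by (auto simp: piles_def)
  have mN: "m \<le> length I" "r \<le> length I" "f 1 < length I"
    using layout_facts(4,5)[OF l] layout_facts(8)[OF l, of 1] hm hp by auto
  have f1: "f 1 \<in> set (xs @ [f 1])" by simp
  have keep: "piles M I d U (xs @ [f 1]) (f(1 := r)) m (Suc r) h \<and> heap_hole I d 1 h (f(1 := r)) 1"
    if "r < length I" "key_le I d (f 1) r"
    using layout_overwrite[OF l, of 1] that hm hp by (intro piles_step[OF p hp]) auto
  have later: "piles M I d U (xs @ [f 1]) (f(1 := f h, h := r)) m (Suc r) (h - 1) \<and>
      heap_hole I d 1 (h - 1) (f(1 := f h, h := r)) 1"
    if "r < length I" "\<not> key_le I d (f 1) r"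
    using layout_replace[OF l, of h] that hm hp heap_min[OF hp(1), of h] by (intro piles_step[OF p hp]) auto
  have shrink: "piles M I d U (xs @ [f 1]) (f(1 := f h, h := f m)) (m - 1) r (h - 1) \<and>
      heap_hole I d 1 (h - 1) (f(1 := f h, h := f m)) 1"
    if "\<not> r < length I"
  proof -
    have "r = length I" using that mN by simp
    \<comment> \<open>Cell \<open>h\<close> leaves the heap and receives \<open>f m\<close>, which
      has to be a waiting position. For \<open>h = m\<close> the cell disappears altogether.\<close>
    moreover have "\<exists>y\<in>set xs. \<not> key_le I d y (f m)" if "h < m"
      using p that by (auto simp: piles_def)
    ultimately show ?thesis
      using layout_pop[of M "length I" f m _ h] l hm hp heap_min[OF hp(1), of h]
      by (intro piles_step[OF p hp]) auto
  qed
  \<comment> \<open>The program reads cell \<open>m\<close> after overwriting cell \<open>1\<close>.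
    If these coincide, then \<open>h = 1\<close> too and the old value was written back.\<close>
  have "(f(1 := f h)) m = f m" using hm hp(2) by auto
  then have "piles M I d U (xs @ [f 1]) (f(1 := f h, h := (f(1 := f h)) m)) (m - 1) r (h - 1) \<and>
      heap_hole I d 1 (h - 1) (f(1 := f h, h := (f(1 := f h)) m)) 1"
    if "\<not> r < length I"
    using shrink[OF that] by (simp only:)
  then show ?thesis
    using keep later N hm mN hp(2) unfolding pop_def
    by (cases "r < length I"; cases "key_le I d (f 1) r"; cases e;
      simp add: wp_simps bval_key_less_eq frame_def keeps_def piles_state_def emits_def defs)
qed

section \<open>Building the heap and completing a run\<close>

definition heapify :: "bool \<Rightarrow> com" where
  "heapify d =
    Seq (Assign ''h'' (Var ''m''))
    (Seq (Assign ''q'' (Var ''m''))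
    (While (Less (Const 0) (Var ''q''))
      (Seq (Assign ''i'' (Var ''q''))
      (Seq (sift d)
      (Assign ''q'' (Sub (Var ''q'') (Const 1)))))))"

definition run :: "bool \<Rightarrow> bool \<Rightarrow> com" where
  "run e d = Seq (heapify d) (While (Less (Const 0) (Var ''h'')) (Seq (pop e d) (sift d)))"

definition layout_state :: "nat \<Rightarrow> 'a::linorder list \<Rightarrow> nat set \<Rightarrow> state \<Rightarrow> bool" where
  "layout_state M I U s \<longleftrightarrow> reg s ''N'' = length I \<and>
    layout M (length I) (mem s) (reg s ''m'') (reg s ''r'') U"

text \<open>Bottom-up construction: the invariant is heap order for all parents beyond
  \<open>q\<close>. Each of the \<open>m\<close> sifts is charged the full height, a cost
  proportional to \<open>m * n\<close> that the following run can repay because it writes at least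
  \<open>m\<close> positions.\<close>

lemma wp_heapify:
  assumes l: "layout_state M I U s" and n: "length I < 2 ^ n"
  shows "wp I (heapify d) (\<lambda>t s'. t \<le> 60 * (n + 1) * (reg s ''m'' + 1) \<and> piles_state M I d U [] s' \<and>
    reg s' ''h'' = reg s' ''m'' \<and> reg s' ''m'' = reg s ''m'' \<and> heap I d 1 (reg s' ''h'') (mem s') \<and>
    emitted s' = emitted s \<and> frame (length I) s s') s"
proof -
  define m where "m = reg s ''m''"
  define s0 where "s0 = s\<lparr>reg := (reg s)(''h'' := m, ''q'' := m)\<rparr>"
  have lay: "layout M (length I) (mem s) m (reg s ''r'') U" and N: "reg s ''N'' = length I"
    using l by (auto simp: layout_state_def m_def)
  note facts = layout_facts[OF lay]
  have mN: "m \<le> length I" using facts(4,5) by simp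
  define P where "P s' \<longleftrightarrow> reg s' ''h'' = m \<and> reg s' ''q'' \<le> m \<and> heap I d (Suc (reg s' ''q'')) m (mem s') \<and>
    rearranged m (mem s) (mem s') \<and> keeps {''h'', ''q'', ''i'', ''j'', ''x''} s s' \<and> emitted s' = emitted s" for s'
  define T where "T s' = (60 * n + 30) * reg s' ''q'' + 10" for s' :: state
  have "wp I (While (Less (Const 0) (Var ''q'')) (Seq (Assign ''i'' (Var ''q''))
      (Seq (sift d) (Assign ''q'' (Sub (Var ''q'') (Const 1))))))
    (\<lambda>t s'. P s' \<and> \<not> bval I (Less (Const 0) (Var ''q'')) s' \<and> t \<le> T s0) s0"
  proof (rule wp_While)
    show "P s0" by (auto simp: P_def s0_def keeps_def heap_def)
  next
    fix s1 assume P: "P s1" and "bval I (Less (Const 0) (Var ''q'')) s1"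
    then have q: "1 \<le> reg s1 ''q''" "reg s1 ''q'' \<le> m" by (auto simp: P_def)
    define s2 where "s2 = s1\<lparr>reg := (reg s1)(''i'' := reg s1 ''q'')\<rparr>"
    have "wp I (sift d) (\<lambda>t s'. t \<le> 60 * n + 10 \<and> keeps {''i'', ''j'', ''x''} s2 s' \<and> emitted s' = emitted s2 \<and>
      heap I d (reg s1 ''q'') m (mem s') \<and> rearranged m (mem s2) (mem s')) s2"
    proof (rule wp_sift)
      show "reg s2 ''i'' = reg s1 ''q''" "reg s2 ''h'' = m" using P by (auto simp: s2_def P_def)
      show "m < reg s1 ''q'' * 2 ^ n" using mN n q(1)
        by (metis le_less_trans less_le_trans mult_le_mono1 nat_mult_1)
      show "heap_hole I d (reg s1 ''q'') m (mem s2) (reg s1 ''q'')"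
        using P q(1) by (intro heap_hole_start) (auto simp: P_def s2_def)
      fix x assume x: "1 \<le> x" "x \<le> m"
      have "mem s y < length I" if "1 \<le> y" "y \<le> m" for y
        using facts(8)[OF that] facts(4) by simp
      then show "mem s2 x < length I"
        using rearranged_ball[of m "mem s" "mem s1" "\<lambda>z. z < length I" x] P x by (auto simp: P_def s2_def)
    qed (use q in auto)
    then have "wp I (sift d) (\<lambda>t s'. P (s'\<lparr>reg := (reg s')(''q'' := reg s' ''q'' - 1)\<rparr>) \<and>
      12 + t + T (s'\<lparr>reg := (reg s')(''q'' := reg s' ''q'' - 1)\<rparr>) \<le> T s1) s2"
    proof (rule wp_mono, elim conjE)
      fix t :: nat and s3
      assume a: "t \<le> 60 * n + 10" "keeps {''i'', ''j'', ''x''} s2 s3" "emitted s3 = emitted s2"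
        "heap I d (reg s1 ''q'') m (mem s3)" "rearranged m (mem s2) (mem s3)"
      have q3: "reg s3 ''q'' = reg s1 ''q''" "reg s3 ''h'' = m"
        using P keepsD[OF a(2)] by (auto simp: s2_def P_def)
      have "rearranged m (mem s) (mem s3)"
        using P a(5) rearranged_trans by (auto simp: P_def s2_def)
      moreover have "T s1 = (60 * n + 30) * (reg s1 ''q'' - 1) + 60 * n + 40"
        using q(1) by (cases "reg s1 ''q''") (auto simp: T_def)
      ultimately show "P (s3\<lparr>reg := (reg s3)(''q'' := reg s3 ''q'' - 1)\<rparr>) \<and>
          12 + t + T (s3\<lparr>reg := (reg s3)(''q'' := reg s3 ''q'' - 1)\<rparr>) \<le> T s1"
        using P a q q3 by (auto simp: wp_simps P_def T_def keeps_def s2_def)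
    qed
    then show "wp I (Seq (Assign ''i'' (Var ''q'')) (Seq (sift d) (Assign ''q'' (Sub (Var ''q'') (Const 1)))))
      (\<lambda>t s'. P s' \<and> 1 + bcost (Less (Const 0) (Var ''q'')) + t + T s' \<le> T s1) s1"
      by (simp add: wp_simps s2_def) (erule wp_mono, simp)
  qed (auto simp: T_def)
  then have "wp I (While (Less (Const 0) (Var ''q'')) (Seq (Assign ''i'' (Var ''q''))
      (Seq (sift d) (Assign ''q'' (Sub (Var ''q'') (Const 1))))))
    (\<lambda>t s'. 6 + t \<le> 60 * (n + 1) * (m + 1) \<and> piles_state M I d U [] s' \<and>
      reg s' ''h'' = reg s' ''m'' \<and> reg s' ''m'' = m \<and> heap I d 1 (reg s' ''h'') (mem s') \<and>
      emitted s' = emitted s \<and> frame (length I) s s') s0"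
  proof (rule wp_mono, elim conjE)
    fix t s' assume P: "P s'" and "\<not> bval I (Less (Const 0) (Var ''q'')) s'" and t: "t \<le> T s0"
    then have q: "reg s' ''q'' = 0" by simp
    have k: "keeps {''h'', ''q'', ''i'', ''j'', ''x''} s s'" and re: "rearranged m (mem s) (mem s')"
      using P by (auto simp: P_def)
    have "T s0 = (60 * n + 30) * m + 10" by (simp add: T_def s0_def)
    then have "6 + t \<le> 60 * (n + 1) * (m + 1)" using t by (simp add: algebra_simps)
    moreover have "layout M (length I) (mem s') m (reg s ''r'') U"
      using layout_rearranged[OF lay re] .
    moreover have "reg s' ''m'' = m" "reg s' ''r'' = reg s ''r''" "reg s' ''N'' = length I" "reg s' ''h'' = m"
      using k P N by (auto simp: keeps_def m_def P_def)
    moreover have "frame (length I) s s'"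
      using k rearranged_outside[OF re] mN by (auto simp: frame_def keeps_def)
    ultimately show "6 + t \<le> 60 * (n + 1) * (m + 1) \<and> piles_state M I d U [] s' \<and>
      reg s' ''h'' = reg s' ''m'' \<and> reg s' ''m'' = m \<and> heap I d 1 (reg s' ''h'') (mem s') \<and>
      emitted s' = emitted s \<and> frame (length I) s s'"
      using P q by (auto simp: P_def piles_state_def piles_def intro: greedy_Nil)
  qed
  then show ?thesis
    unfolding heapify_def by (simp add: wp_simps m_def[symmetric] s0_def)
qed


lemma wp_run_step:
  assumes p: "piles_state M I d U xs s" and hp: "heap I d 1 (reg s ''h'') (mem s)" and h: "1 \<le> reg s ''h''"
    and n: "length I < 2 ^ n"
  shows "wp I (Seq (pop e d) (sift d)) (\<lambda>t s'. t \<le> 60 * n + 70 \<and> piles_state M I d U (xs @ [mem s 1]) s' \<and>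
    heap I d 1 (reg s' ''h'') (mem s') \<and> emitted s' = emitted s @ emits e [mem s 1] \<and> frame (length I) s s') s"
  unfolding wp_simps(5)
proof (rule wp_mono[OF wp_pop[OF p hp h]], elim conjE)
  fix t :: nat and s1
  assume t: "t \<le> 50" and p1: "piles_state M I d U (xs @ [mem s 1]) s1"
    and hole: "heap_hole I d 1 (reg s1 ''h'') (mem s1) 1" and i: "reg s1 ''i'' = 1"
    and em: "emitted s1 = emitted s @ emits e [mem s 1]" and fr: "frame (length I) s s1"
  let ?h = "reg s1 ''h''"
  have p1': "piles M I d U (xs @ [mem s 1]) (mem s1) (reg s1 ''m'') (reg s1 ''r'') ?h"
    using p1 by (simp add: piles_state_def)
  then have l: "layout M (length I) (mem s1) (reg s1 ''m'') (reg s1 ''r'') (U - set (xs @ [mem s 1]))"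
    and hm: "?h \<le> reg s1 ''m''" by (auto simp: piles_def)
  have hN: "?h \<le> length I" using layout_facts(4,5)[OF l] hm by simp
  have "wp I (sift d) (\<lambda>t s'. t \<le> 60 * n + 10 \<and> keeps {''i'', ''j'', ''x''} s1 s' \<and> emitted s' = emitted s1 \<and>
      heap I d 1 ?h (mem s') \<and> rearranged ?h (mem s1) (mem s')) s1"
  proof (rule wp_sift[OF i refl])
    show "?h < 1 * 2 ^ n" using hN n by simp
    show "mem s1 x < length I" if "1 \<le> x" "x \<le> ?h" for x
      using layout_facts(4)[OF l] layout_facts(8)[OF l, of x] hm that by simp
  qed (use hole in auto)
  then show "wp I (sift d) (\<lambda>t' s'. 1 + t + t' \<le> 60 * n + 70 \<and> piles_state M I d U (xs @ [mem s 1]) s' \<and>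
    heap I d 1 (reg s' ''h'') (mem s') \<and> emitted s' = emitted s @ emits e [mem s 1] \<and> frame (length I) s s') s1"
  proof (rule wp_mono, elim conjE)
    fix t' s2
    assume t': "t' \<le> 60 * n + 10" and k: "keeps {''i'', ''j'', ''x''} s1 s2" and em2: "emitted s2 = emitted s1"
      and hp2: "heap I d 1 ?h (mem s2)" and re: "rearranged ?h (mem s1) (mem s2)"
    have "reg s2 ''h'' = ?h" "reg s2 ''m'' = reg s1 ''m''" "reg s2 ''r'' = reg s1 ''r''" "reg s2 ''N'' = reg s1 ''N''"
      using keepsD[OF k] by auto
    moreover have "frame (length I) s1 s2"
      using k rearranged_outside[OF re] hN by (auto simp: frame_def keeps_def)
    ultimately show "1 + t + t' \<le> 60 * n + 70 \<and> piles_state M I d U (xs @ [mem s 1]) s2 \<and>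
      heap I d 1 (reg s2 ''h'') (mem s2) \<and> emitted s2 = emitted s @ emits e [mem s 1] \<and> frame (length I) s s2"
      using t t' em em2 hp2 p1 piles_rearranged[OF p1' re] frame_trans[OF fr]
      by (simp add: piles_state_def)
  qed
qed

lemma writable_card:
  assumes "writable M U xs" "finite U"
  shows "card (U - set xs) + length xs = card U"
proof -
  have "card (set xs) = length xs" using writable_distinct[OF assms(1)] by (rule distinct_card)
  moreover have "card (set xs) \<le> card U" using writable_subset[OF assms(1)] assms(2) by (intro card_mono)
  ultimately show ?thesis using writable_subset[OF assms(1)] assms(2) by (simp add: card_Diff_subset)
qed

definition run_result :: "nat \<Rightarrow> 'a::linorder list \<Rightarrow> bool \<Rightarrow> bool \<Rightarrow> nat set \<Rightarrow> state \<Rightarrow> nat list \<Rightarrow> state \<Rightarrow> bool" where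
  "run_result M I e d U s xs s' \<longleftrightarrow> writable M U xs \<and> sorted_wrt (key_le I d) xs \<and>
    rest M I d U = U - set xs \<and> layout_state M I (U - set xs) s' \<and>
    emitted s' = emitted s @ emits e xs \<and> frame (length I) s s'"

text \<open>When the heap is empty, every buffered position is waiting, so the greedy run is stuck
  and hence maximal. The \<open>+ 1\<close> in the bound covers a run from an empty buffer.\<close>

lemma wp_run:
  assumes l: "layout_state M I U s" and n: "length I < 2 ^ n"
  shows "wp I (run e d) (\<lambda>t s'. \<exists>xs. run_result M I e d U s xs s' \<and> t \<le> 150 * (n + 1) * (length xs + 1)) s"
proof -
  have lay: "layout M (length I) (mem s) (reg s ''m'') (reg s ''r'') U"
    using l by (auto simp: layout_state_def)
  note facts = layout_facts[OF lay]
  define c where "c = card (rest M I d U)"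
  define P where "P s' \<longleftrightarrow> (\<exists>xs. piles_state M I d U xs s' \<and> heap I d 1 (reg s' ''h'') (mem s') \<and>
    emitted s' = emitted s @ emits e xs \<and> frame (length I) s s')" for s'
  \<comment> \<open>\<open>m + N - r\<close> counts the unwritten positions and \<open>c\<close>
    those that remain after the run, so each write still to come is charged
    \<open>60 * n + 80\<close>: one pop with its sift and the loop test.\<close>
  define T where "T s' = (60 * n + 80) * (reg s' ''m'' + length I - reg s' ''r'' - c) + 10" for s' :: state
  have card: "reg s' ''m'' + length I - reg s' ''r'' = card (U - set xs)" "c \<le> card (U - set xs)"
    if "piles_state M I d U xs s'" for xs s'
  proof -
    have l': "layout M (length I) (mem s') (reg s' ''m'') (reg s' ''r'') (U - set xs)" and g: "greedy M I d U xs"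
      using that by (auto simp: piles_state_def piles_def)
    show "reg s' ''m'' + length I - reg s' ''r'' = card (U - set xs)"
      using layout_facts(2)[OF l'] by simp
    have "rest M I d U \<subseteq> U - set xs" using greedy_run[OF g] rest_writable by blast
    then show "c \<le> card (U - set xs)" unfolding c_def using facts(3) by (intro card_mono) auto
  qed
  have loop: "wp I (While (Less (Const 0) (Var ''h'')) (Seq (pop e d) (sift d)))
    (\<lambda>t s'. P s' \<and> \<not> bval I (Less (Const 0) (Var ''h'')) s' \<and> t \<le> T s1) s1" if "P s1" for s1
  proof (rule wp_While)
    fix s2 assume "P s2" "bval I (Less (Const 0) (Var ''h'')) s2"
    then obtain xs where p: "piles_state M I d U xs s2" and hp: "heap I d 1 (reg s2 ''h'') (mem s2)"
      and em: "emitted s2 = emitted s @ emits e xs" and fr: "frame (length I) s s2" and h: "1 \<le> reg s2 ''h''"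
      by (auto simp: P_def)
    show "wp I (Seq (pop e d) (sift d))
      (\<lambda>t s'. P s' \<and> 1 + bcost (Less (Const 0) (Var ''h'')) + t + T s' \<le> T s2) s2"
    proof (rule wp_mono[OF wp_run_step[OF p hp h n]], elim conjE)
      fix t :: nat and s3
      assume t: "t \<le> 60 * n + 70" and p3: "piles_state M I d U (xs @ [mem s2 1]) s3"
        and rest: "heap I d 1 (reg s3 ''h'') (mem s3)" "emitted s3 = emitted s2 @ emits e [mem s2 1]"
          "frame (length I) s2 s3"
      have "P s3"
        unfolding P_def using p3 rest em frame_trans[OF fr]
        by (intro exI[of _ "xs @ [mem s2 1]"]) (simp add: emits_append)
      moreover have "card (U - set (xs @ [mem s2 1])) + 1 = card (U - set xs)"
      proof -
        have "writable M U (xs @ [mem s2 1])" "writable M U xs"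
          using p3 p greedy_run[of M I d U] by (simp_all add: piles_state_def piles_def)
        from this[THEN writable_card, OF facts(3)] show ?thesis by simp
      qed
      then have "card (U - set xs) - c = Suc (card (U - set (xs @ [mem s2 1])) - c)"
        using card(2)[OF p3] by linarith
      then have "T s2 = T s3 + (60 * n + 80)"
        unfolding T_def card(1)[OF p] card(1)[OF p3] by (simp only: mult_Suc_right)
      ultimately show "P s3 \<and> 1 + bcost (Less (Const 0) (Var ''h'')) + t + T s3 \<le> T s2" using t by simp
    qed
  qed (use that in \<open>auto simp: T_def\<close>)
  show ?thesis
    unfolding run_def wp_simps(5)
  proof (rule wp_mono[OF wp_heapify[OF l n]], elim conjE)
    fix t :: nat and s1
    assume t: "t \<le> 60 * (n + 1) * (reg s ''m'' + 1)" and p1: "piles_state M I d U [] s1"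
      and "reg s1 ''h'' = reg s1 ''m''" "reg s1 ''m'' = reg s ''m''"
      and "heap I d 1 (reg s1 ''h'') (mem s1)" "emitted s1 = emitted s" "frame (length I) s s1"
    then have "P s1" by (auto simp: P_def emits_def)
    from loop[OF this] show "wp I (While (Less (Const 0) (Var ''h'')) (Seq (pop e d) (sift d)))
      (\<lambda>t' s'. \<exists>xs. run_result M I e d U s xs s' \<and> 1 + t + t' \<le> 150 * (n + 1) * (length xs + 1)) s1"
    proof (rule wp_mono, elim conjE)
      fix t' s2
      assume "P s2" and "\<not> bval I (Less (Const 0) (Var ''h'')) s2" and t': "t' \<le> T s1"
      then obtain xs where p2: "piles_state M I d U xs s2" and h: "reg s2 ''h'' = 0"
        and em: "emitted s2 = emitted s @ emits e xs" and fr: "frame (length I) s s2"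
        by (auto simp: P_def)
      have l2: "layout_state M I (U - set xs) s2" and g: "greedy M I d U xs"
        and stuck: "\<forall>x\<in>{1..reg s2 ''m''}. \<exists>y\<in>set xs. \<not> key_le I d y (mem s2 x)"
        using p2 h by (auto simp: piles_state_def piles_def layout_state_def)
      have b: "buffer M (U - set xs) = mem s2 ` {1..reg s2 ''m''}"
        using layout_facts(1) l2 by (auto simp: layout_state_def)
      have rest: "rest M I d U = U - set xs"
        using greedy_rest[OF g facts(3)] stuck b by auto
      have w: "writable M U xs" "sorted_wrt (key_le I d) xs" using greedy_run[OF g] by auto
      have "card (buffer M U) = reg s ''m''"
        using lay facts(1) by (auto simp: layout_def card_image)
      moreover have "buffer M U \<subseteq> set xs" using rest rest_buffer[of M I d U] buffer_subset[of M U] by auto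
      ultimately have "reg s ''m'' \<le> length xs"
        by (metis List.finite_set card_length card_mono le_trans)
      then have "60 * (n + 1) * (reg s ''m'' + 1) \<le> 60 * (n + 1) * (length xs + 1)" by (intro mult_le_mono) auto
      moreover have "T s1 = (60 * n + 80) * length xs + 10"
        using card[OF p1] writable_card[OF w(1) facts(3)] by (simp add: T_def c_def rest)
      ultimately have "1 + t + t' \<le> 150 * (n + 1) * (length xs + 1)"
        using t t' by (simp add: algebra_simps)
      then show "\<exists>xs. run_result M I e d U s xs s2 \<and> 1 + t + t' \<le> 150 * (n + 1) * (length xs + 1)"
        using w rest l2 em fr by (auto simp: run_result_def)
    qed
  qed
qed

section \<open>Trying all short sequences of directions\<close>

text \<open>The guard skips runs from an empty buffer. Every executed run then writes something, to
  which its constant overhead can be charged.\<close>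

primrec path :: "bool \<Rightarrow> bool list \<Rightarrow> com" where
  "path e [] = Skip"
| "path e (d # ds) = If (Less (Const 0) (Var ''m'')) (Seq (run e d) (path e ds)) Skip"

definition path_result :: "nat \<Rightarrow> 'a::linorder list \<Rightarrow> bool \<Rightarrow> bool list \<Rightarrow> nat set \<Rightarrow> state \<Rightarrow>
    nat list list \<Rightarrow> state \<Rightarrow> bool" where
  "path_result M I e ds U s Xs s' \<longleftrightarrow> length Xs \<le> length ds \<and> (\<forall>X\<in>set Xs. \<exists>d. sorted_wrt (key_le I d) X) \<and>
    writable M U (concat Xs) \<and> rests M I ds U = U - set (concat Xs) \<and>
    layout_state M I (rests M I ds U) s' \<and> emitted s' = emitted s @ emits e (concat Xs) \<and>
    frame (length I) s s'"

text \<open>Unread input keeps the buffer full, so for positive \<open>M\<close> an empty buffer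
  means that the input is exhausted.\<close>

lemma layout_empty:
  assumes "layout M N f 0 r U" "1 \<le> M"
  shows "U = {}"
proof -
  have "r = N" using layout_facts(4,7)[OF assms(1)] assms(2) by force
  then show ?thesis using layout_facts(2,3)[OF assms(1)] by simp
qed

lemma wp_path:
  assumes M: "1 \<le> M" and b: "length I < 2 ^ b" and l: "layout_state M I U s"
  shows "wp I (path e ds) (\<lambda>t s'. \<exists>Xs. path_result M I e ds U s Xs s' \<and>
    t \<le> 310 * (b + 1) * length (concat Xs) + 5) s"
  using l
proof (induction ds arbitrary: U s)
  case Nil
  have "path_result M I e [] U s [] s" using Nil by (simp add: path_result_def emits_def)
  then show ?case by (auto simp: wp_simps intro!: exI[of _ "[]"])
next
  case (Cons d ds)
  show ?case
  proof (cases "reg s ''m'' = 0")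
    case True
    then have "U = {}" using Cons.prems layout_empty[OF _ M] by (fastforce simp: layout_state_def)
    then have "path_result M I e (d # ds) U s [] s"
      using Cons.prems rests_subset[of M I "d # ds" "{}"] by (auto simp: path_result_def emits_def)
    then show ?thesis using True by (auto simp: wp_simps intro!: exI[of _ "[]"])
  next
    case False
    have "wp I (Seq (run e d) (path e ds)) (\<lambda>t s'. \<exists>Xs. path_result M I e (d # ds) U s Xs s' \<and>
      4 + t \<le> 310 * (b + 1) * length (concat Xs) + 5) s"
      unfolding wp_simps(5)
    proof (rule wp_mono[OF wp_run[OF Cons.prems b]], elim exE conjE)
      fix t :: nat and s1 X
      assume X: "run_result M I e d U s X s1" and t: "t \<le> 150 * (b + 1) * (length X + 1)"
      have "buffer M U \<noteq> {}"
        using layout_facts(1) Cons.prems False by (auto simp: layout_state_def)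
      moreover have "buffer M U \<subseteq> set X"
        using X rest_buffer[of M I d U] buffer_subset[of M U] by (auto simp: run_result_def)
      ultimately have len: "1 \<le> length X" by (cases X) auto
      have l1: "layout_state M I (U - set X) s1" using X by (simp add: run_result_def)
      show "wp I (path e ds) (\<lambda>t' s'. \<exists>Xs. path_result M I e (d # ds) U s Xs s' \<and>
        4 + (1 + t + t') \<le> 310 * (b + 1) * length (concat Xs) + 5) s1"
      proof (rule wp_mono[OF Cons.IH[OF l1]], elim exE conjE)
        fix t' :: nat and s2 Xs
        assume Xs: "path_result M I e ds (U - set X) s1 Xs s2"
          and t': "t' \<le> 310 * (b + 1) * length (concat Xs) + 5"
        have "frame (length I) s s2"
          using X Xs frame_trans unfolding run_result_def path_result_def by blast
        then have "path_result M I e (d # ds) U s (X # Xs) s2"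
          using X Xs by (auto simp: run_result_def path_result_def writable_append emits_append)
        \<comment> \<open>As \<open>X\<close> is nonempty, the \<open>+ 1\<close> of
          \<open>wp_run\<close> at most doubles its cost; 310 is twice 150 plus room for the control
          steps.\<close>
        moreover have "(b + 1) * 1 \<le> (b + 1) * length X" using len by (rule mult_le_mono2)
        then have "4 + (1 + t + t') \<le> 310 * (b + 1) * length (concat (X # Xs)) + 5"
          using t t' by (simp add: algebra_simps)
        ultimately show "\<exists>Xs. path_result M I e (d # ds) U s Xs s2 \<and>
          4 + (1 + t + t') \<le> 310 * (b + 1) * length (concat Xs) + 5" by blast
      qed
    qed
    then show ?thesis using False by (simp add: wp_simps(6))
  qed
qed

section \<open>Saving and restoring the buffer\<close>

definition copy :: "aexp \<Rightarrow> aexp \<Rightarrow> com" where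
  "copy a c =
    Seq (Assign ''q'' (Const 0))
    (While (Less (Var ''q'') (Var ''m''))
      (Seq (Assign ''q'' (Add (Var ''q'') (Const 1)))
      (Store (Add c (Var ''q'')) (Load (Add a (Var ''q''))))))"

lemma wp_copy:
  assumes a: "\<And>s'. keeps {''q''} s s' \<Longrightarrow> aval a s' = A" "acost a = 1"
    and c: "\<And>s'. keeps {''q''} s s' \<Longrightarrow> aval c s' = C" "acost c = 1"
    and m: "reg s ''m'' = m" and disj: "A + m \<le> C \<or> C + m \<le> A"
  shows "wp I (copy a c) (\<lambda>t s'. t \<le> 20 * m + 20 \<and> keeps {''q''} s s' \<and> emitted s' = emitted s \<and>
    (\<forall>x\<in>{1..m}. mem s' (C + x) = mem s (A + x)) \<and> (\<forall>y. y \<notin> {C + 1..C + m} \<longrightarrow> mem s' y = mem s y)) s"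
proof -
  define s0 where "s0 = s\<lparr>reg := (reg s)(''q'' := 0)\<rparr>"
  define P where "P s' \<longleftrightarrow> reg s' ''q'' \<le> m \<and> keeps {''q''} s s' \<and> emitted s' = emitted s \<and>
    (\<forall>x\<in>{1..reg s' ''q''}. mem s' (C + x) = mem s (A + x)) \<and>
    (\<forall>y. y \<notin> {C + 1..C + reg s' ''q''} \<longrightarrow> mem s' y = mem s y)" for s'
  define T where "T s' = 20 * (m - reg s' ''q'') + 10" for s' :: state
  let ?body = "Seq (Assign ''q'' (Add (Var ''q'') (Const 1)))
      (Store (Add c (Var ''q'')) (Load (Add a (Var ''q''))))"
  have "wp I (While (Less (Var ''q'') (Var ''m'')) ?body)
    (\<lambda>t s'. P s' \<and> \<not> bval I (Less (Var ''q'') (Var ''m'')) s' \<and> t \<le> T s0) s0"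
  proof (rule wp_While)
    show "P s0" by (auto simp: P_def s0_def keeps_def)
  next
    fix s1 assume P: "P s1" and "bval I (Less (Var ''q'') (Var ''m'')) s1"
    then have q: "reg s1 ''q'' < m" using m by (auto simp: P_def keeps_def)
    define s2 where "s2 = s1\<lparr>reg := (reg s1)(''q'' := Suc (reg s1 ''q''))\<rparr>"
    have "keeps {''q''} s s2" using P by (auto simp: P_def keeps_def s2_def)
    then have ac: "aval a s2 = A" "aval c s2 = C" using a c by auto
    define s3 where "s3 = s2\<lparr>mem := (mem s2)(C + Suc (reg s1 ''q'') := mem s2 (A + Suc (reg s1 ''q'')))\<rparr>"
    have "mem s2 (A + Suc (reg s1 ''q'')) = mem s (A + Suc (reg s1 ''q''))"
      using P q disj by (auto simp: P_def s2_def)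
    then have "P s3"
      using P q by (auto simp: P_def s3_def s2_def keeps_def le_Suc_eq)
    moreover have "T s1 = T s3 + 20" using q by (simp add: T_def s3_def s2_def)
    ultimately show "wp I ?body (\<lambda>t s'. P s' \<and> 1 + bcost (Less (Var ''q'') (Var ''m'')) + t + T s' \<le> T s1) s1"
      using a(2) c(2) ac by (simp add: wp_simps s2_def s3_def)
  qed (auto simp: T_def)
  then have "wp I (While (Less (Var ''q'') (Var ''m'')) ?body)
    (\<lambda>t s'. 3 + t \<le> 20 * m + 20 \<and> keeps {''q''} s s' \<and> emitted s' = emitted s \<and>
      (\<forall>x\<in>{1..m}. mem s' (C + x) = mem s (A + x)) \<and> (\<forall>y. y \<notin> {C + 1..C + m} \<longrightarrow> mem s' y = mem s y)) s0"
  proof (rule wp_mono, elim conjE)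
    fix t s' assume P: "P s'" and nb: "\<not> bval I (Less (Var ''q'') (Var ''m'')) s'" and t: "t \<le> T s0"
    have "reg s' ''q'' = m" using P nb m by (auto simp: P_def keeps_def)
    then show "3 + t \<le> 20 * m + 20 \<and> keeps {''q''} s s' \<and> emitted s' = emitted s \<and>
      (\<forall>x\<in>{1..m}. mem s' (C + x) = mem s (A + x)) \<and> (\<forall>y. y \<notin> {C + 1..C + m} \<longrightarrow> mem s' y = mem s y)"
      using P t by (auto simp: P_def T_def s0_def)
  qed
  then show ?thesis
    unfolding copy_def wp_simps by (auto simp: s0_def elim!: wp_mono)
qed

definition saved :: "nat \<Rightarrow> 'a::linorder list \<Rightarrow> nat set \<Rightarrow> state \<Rightarrow> bool" where
  "saved M I U s \<longleftrightarrow> reg s ''N'' = length I \<and>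
    layout M (length I) (\<lambda>x. mem s (length I + x)) (reg s ''m0'') (reg s ''r0'') U"

lemma frame_regs:
  assumes "frame N s s'"
  shows "reg s' ''N'' = reg s ''N''" "reg s' ''m0'' = reg s ''m0''" "reg s' ''r0'' = reg s ''r0''"
    "reg s' ''best'' = reg s ''best''" "reg s' ''bi'' = reg s ''bi''"
  using assms by (simp_all add: frame_def keeps_def)

lemma saved_frame:
  assumes "saved M I U s" "frame (length I) s s'"
  shows "saved M I U s'"
proof -
  have "layout M (length I) (\<lambda>x. mem s' (length I + x)) (reg s ''m0'') (reg s ''r0'') U"
  proof (rule layout_cong)
    show "layout M (length I) (\<lambda>x. mem s (length I + x)) (reg s ''m0'') (reg s ''r0'') U"
      using assms by (simp add: saved_def)
  qed (use assms in \<open>simp add: frame_def\<close>)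
  then show ?thesis using assms(1) frame_regs[OF assms(2)] by (simp add: saved_def)
qed

text \<open>\<open>r - m\<close> is the number of positions already written. The search thus starts
  with candidate 0, the empty sequence, as the current best.\<close>

definition save :: com where
  "save =
    Seq (copy (Const 0) (Var ''N''))
    (Seq (Assign ''m0'' (Var ''m''))
    (Seq (Assign ''r0'' (Var ''r''))
    (Seq (Assign ''best'' (Sub (Var ''r'') (Var ''m'')))
    (Assign ''bi'' (Const 0)))))"

definition restore :: com where
  "restore =
    Seq (Assign ''m'' (Var ''m0''))
    (Seq (Assign ''r'' (Var ''r0''))
    (copy (Var ''N'') (Const 0)))"

lemma wp_save:
  assumes "layout_state M I U s"
  shows "wp I save (\<lambda>t s'. t \<le> 20 * reg s ''m'' + 40 \<and> saved M I U s' \<and> reg s' ''m0'' = reg s ''m'' \<and>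
    reg s' ''bi'' = 0 \<and> reg s' ''best'' + card U = length I \<and> emitted s' = emitted s) s"
proof -
  have N: "reg s ''N'' = length I" and l: "layout M (length I) (mem s) (reg s ''m'') (reg s ''r'') U"
    using assms by (auto simp: layout_state_def)
  note facts = layout_facts[OF l]
  show ?thesis
    unfolding save_def wp_simps(5)
  proof (rule wp_mono[OF wp_copy[where A = 0 and C = "length I" and m = "reg s ''m''"]], goal_cases)
    case (7 t s')
    then have r: "reg s' ''N'' = length I" "reg s' ''m'' = reg s ''m''" "reg s' ''r'' = reg s ''r''"
      using N by (auto simp: keeps_def)
    have "layout M (length I) (\<lambda>x. mem s' (length I + x)) (reg s ''m'') (reg s ''r'') U"
      using 7 by (intro layout_cong[OF l]) auto
    then show ?case
      using 7 r facts by (simp add: wp_simps saved_def)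
  qed (use N facts in \<open>auto simp: keeps_def\<close>)
qed

lemma wp_restore:
  assumes "saved M I U s"
  shows "wp I restore (\<lambda>t s'. t \<le> 20 * reg s ''m0'' + 40 \<and> layout_state M I U s' \<and>
    frame (length I) s s' \<and> emitted s' = emitted s) s"
proof -
  have N: "reg s ''N'' = length I"
    and l: "layout M (length I) (\<lambda>x. mem s (length I + x)) (reg s ''m0'') (reg s ''r0'') U"
    using assms by (auto simp: saved_def)
  note facts = layout_facts[OF l]
  define s1 where "s1 = s\<lparr>reg := (reg s)(''m'' := reg s ''m0'', ''r'' := reg s ''r0'')\<rparr>"
  have "wp I (copy (Var ''N'') (Const 0)) (\<lambda>t s'. 6 + t \<le> 20 * reg s ''m0'' + 40 \<and> layout_state M I U s' \<and>
    frame (length I) s s' \<and> emitted s' = emitted s) s1"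
  proof (rule wp_mono[OF wp_copy[where A = "length I" and C = 0 and m = "reg s ''m0''"]], goal_cases)
    case (7 t s')
    have r: "reg s' ''N'' = length I" "reg s' ''m'' = reg s ''m0''" "reg s' ''r'' = reg s ''r0''"
      using N 7 by (auto simp: keeps_def s1_def)
    have "layout M (length I) (mem s') (reg s ''m0'') (reg s ''r0'') U"
      using 7 by (intro layout_cong[OF l]) (auto simp: s1_def)
    then show ?case
      using 7 r facts(4,5) by (auto simp: layout_state_def frame_def keeps_def s1_def)
  qed (use N facts in \<open>auto simp: keeps_def s1_def\<close>)
  then show ?thesis
    by (simp add: restore_def wp_simps s1_def)
qed


section \<open>Choosing a best direction sequence\<close>

text \<open>Ordered by length, so that the first candidate attaining the maximum is a shortest
  one.\<close>

primrec dirs :: "nat \<Rightarrow> bool list list" where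
  "dirs 0 = [[]]"
| "dirs (Suc k) = dirs k @ List.n_lists (Suc k) [True, False]"

lemma set_dirs: "set (dirs k) = {ds. length ds \<le> k}"
proof (induction k)
  case (Suc k)
  have "set [True, False] = UNIV" by auto
  then show ?case using Suc by (auto simp: set_n_lists le_Suc_eq simp del: n_lists.simps)
qed auto

lemma length_dirs: "length (dirs k) + 1 = 2 ^ Suc k"
proof (induction k)
  case (Suc k)
  have "length (dirs (Suc k)) = length (dirs k) + 2 ^ Suc k"
    using length_n_lists[of "Suc k" "[True, False]"] by (simp add: numeral_2_eq_2 del: n_lists.simps)
  then show ?case using Suc by simp
qed simp

lemma sorted_dirs: "sorted (map length (dirs k))"
proof (induction k)
  case (Suc k)
  have "map length (List.n_lists (Suc k) [True, False]) =
      replicate (length (List.n_lists (Suc k) [True, False])) (Suc k)"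
    by (auto simp: set_n_lists simp del: n_lists.simps replicate.simps intro!: replicate_eqI)
  then have "sorted (map length (List.n_lists (Suc k) [True, False]))"
    by (simp del: n_lists.simps)
  then show ?case
    using Suc by (auto simp: sorted_append set_dirs set_n_lists simp del: n_lists.simps)
qed simp

lemma dirs_0: "dirs k ! 0 = [] \<and> 0 < length (dirs k)"
  by (induction k) (auto simp: nth_append)

text \<open>The list is unrolled into program text, hence sequences need no representation at run
  time: the constant \<open>n\<close> identifies the candidate. The strict comparison keeps the
  earlier one on ties.\<close>

primrec tries :: "nat \<Rightarrow> bool list list \<Rightarrow> com" where
  "tries n [] = Skip"
| "tries n (ds # L) =
    Seq restore
    (Seq (path False ds)
    (Seq (If (Less (Var ''best'') (Sub (Var ''r'') (Var ''m'')))
           (Seq (Assign ''best'' (Sub (Var ''r'') (Var ''m''))) (Assign ''bi'' (Const n))) Skip)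
    (tries (Suc n) L)))"

text \<open>\<open>i \<le> n\<close> rather than \<open>i < n\<close> admits the start, where
  candidate 0 is the current best before any candidate has been tried.\<close>

definition best_of :: "nat \<Rightarrow> 'a::linorder list \<Rightarrow> nat set \<Rightarrow> bool list list \<Rightarrow> nat \<Rightarrow> nat \<Rightarrow> bool" where
  "best_of M I U F n i \<longleftrightarrow> i < length F \<and> i \<le> n \<and>
    (\<forall>j<n. card (rests M I (F ! i) U) \<le> card (rests M I (F ! j) U) \<and>
      (card (rests M I (F ! i) U) = card (rests M I (F ! j) U) \<longrightarrow> length (F ! i) \<le> length (F ! j)))"

lemma best_of_new:
  assumes "best_of M I U F n i" "n < length F" "card (rests M I (F ! n) U) < card (rests M I (F ! i) U)"
  shows "best_of M I U F (Suc n) n"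
proof -
  have "card (rests M I (F ! n) U) < card (rests M I (F ! j) U)" if "j < n" for j
    using assms(1,3) that unfolding best_of_def by (meson less_le_trans)
  then show ?thesis using assms(2) unfolding best_of_def less_Suc_eq by fastforce
qed

text \<open>On a tie the old candidate stays, and it is no longer than the new one because the list
  is sorted by length.\<close>

lemma best_of_old:
  assumes "best_of M I U F n i" "n < length F" "card (rests M I (F ! i) U) \<le> card (rests M I (F ! n) U)"
    "sorted (map length F)"
  shows "best_of M I U F (Suc n) i"
proof -
  have "length (F ! i) \<le> length (F ! n)"
    using sorted_nth_mono[OF assms(4), of i n] assms(1,2) by (simp add: best_of_def)
  then show ?thesis using assms(1,3) by (auto simp: best_of_def less_Suc_eq)
qed

definition search_state :: "nat \<Rightarrow> 'a::linorder list \<Rightarrow> nat set \<Rightarrow> bool list list \<Rightarrow> nat \<Rightarrow> state \<Rightarrow> bool" where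
  "search_state M I U F n s \<longleftrightarrow> saved M I U s \<and> best_of M I U F n (reg s ''bi'') \<and>
    reg s ''best'' + card (rests M I (F ! reg s ''bi'') U) = length I"

text \<open>\<open>W\<close> bounds both the positions written by a trial and the cells copied to
  restore the buffer, which gives the same cost bound for all trials.\<close>

lemma wp_tries:
  assumes M: "1 \<le> M" and b: "length I < 2 ^ b" and sorted: "sorted (map length F)"
    and W: "\<forall>ds\<in>set F. card U \<le> card (rests M I ds U) + W" "m \<le> W"
    and s: "search_state M I U F n s" "reg s ''m0'' = m" "drop n F = L" "n + length L = length F"
  shows "wp I (tries n L) (\<lambda>t s'. search_state M I U F (length F) s' \<and> reg s' ''m0'' = m \<and>
    emitted s' = emitted s \<and> t \<le> length L * (400 * (b + 1) * (W + 1)) + 1) s"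
  using s
proof (induction L arbitrary: n s)
  case Nil
  then show ?case by (simp add: wp_simps)
next
  case (Cons ds L)
  have n: "n < length F" "F ! n = ds" "drop (Suc n) F = L"
    using Cons.prems(3,4) Cons_nth_drop_Suc[of n F] by auto
  have sv: "saved M I U s" using Cons.prems(1) by (simp add: search_state_def)
  show ?case
    unfolding tries.simps wp_simps(5)
  proof (rule wp_mono[OF wp_restore[OF sv]], elim conjE)
    fix t1 :: nat and s1
    assume t1: "t1 \<le> 20 * reg s ''m0'' + 40" and l1: "layout_state M I U s1"
      and fr1: "frame (length I) s s1" and em1: "emitted s1 = emitted s"
    show "wp I (path False ds) (\<lambda>t2 s2. wp I (If (Less (Var ''best'') (Sub (Var ''r'') (Var ''m'')))
           (Seq (Assign ''best'' (Sub (Var ''r'') (Var ''m''))) (Assign ''bi'' (Const n))) Skip)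
        (\<lambda>t3. wp I (tries (Suc n) L) (\<lambda>t4 s'. search_state M I U F (length F) s' \<and> reg s' ''m0'' = m \<and>
          emitted s' = emitted s \<and> 1 + t1 + (1 + t2 + (1 + t3 + t4)) \<le>
            length (ds # L) * (400 * (b + 1) * (W + 1)) + 1)) s2) s1"
    proof (rule wp_mono[OF wp_path[OF M b l1]], elim exE conjE)
      fix t2 :: nat and s2 Xs
      assume Xs: "path_result M I False ds U s1 Xs s2" and t2: "t2 \<le> 310 * (b + 1) * length (concat Xs) + 5"
      have fr: "frame (length I) s s2" using Xs fr1 frame_trans by (auto simp: path_result_def)
      have em: "emitted s2 = emitted s" using Xs em1 by (simp add: path_result_def emits_def)
      have "layout M (length I) (mem s2) (reg s2 ''m'') (reg s2 ''r'') (rests M I ds U)"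
        using Xs unfolding path_result_def layout_state_def by blast
      from layout_facts(2,4,5)[OF this]
      have card: "reg s2 ''r'' - reg s2 ''m'' + card (rests M I ds U) = length I" by linarith
      have "finite U" using layout_facts(3) l1 by (auto simp: layout_state_def)
      moreover have "writable M U (concat Xs)" and rs: "rests M I ds U = U - set (concat Xs)"
        using Xs unfolding path_result_def by blast+
      ultimately have "card (rests M I ds U) + length (concat Xs) = card U"
        unfolding rs by (intro writable_card)
      moreover have "ds \<in> set F" using nth_mem[OF n(1)] n(2) by simp
      then have "card U \<le> card (rests M I ds U) + W" using W(1) by blast
      ultimately have "length (concat Xs) \<le> W" by linarith
      then have "310 * (b + 1) * length (concat Xs) \<le> 310 * (b + 1) * W" by (rule mult_le_mono2)
      then have t: "t1 + t2 \<le> 20 * W + 310 * (b + 1) * W + 45" using t1 t2 W(2) Cons.prems(2) by linarith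
      have next_try: "wp I (tries (Suc n) L) (\<lambda>t4 s'. search_state M I U F (length F) s' \<and> reg s' ''m0'' = m \<and>
          emitted s' = emitted s \<and> 1 + t1 + (1 + t2 + (1 + t3 + t4)) \<le>
            length (ds # L) * (400 * (b + 1) * (W + 1)) + 1) s3"
        if "search_state M I U F (Suc n) s3" "reg s3 ''m0'' = m" "emitted s3 = emitted s" "t3 \<le> 20" for s3 t3
      proof (rule wp_mono[OF Cons.IH[OF that(1,2) n(3)]], goal_cases)
        case 1
        then show ?case using Cons.prems(4) by simp
      next
        case (2 t4 s4)
        then show ?case using that t by (simp add: algebra_simps)
      qed
      have regs: "reg s2 ''m0'' = m" "reg s2 ''bi'' = reg s ''bi''" "reg s2 ''best'' = reg s ''best''"
        using frame_regs[OF fr] Cons.prems(2) by auto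
      have ss: "saved M I U s2" "best_of M I U F n (reg s ''bi'')"
        "reg s ''best'' + card (rests M I (F ! reg s ''bi'') U) = length I"
        using Cons.prems(1) saved_frame[OF _ fr] by (auto simp: search_state_def)
      show "wp I (If (Less (Var ''best'') (Sub (Var ''r'') (Var ''m'')))
           (Seq (Assign ''best'' (Sub (Var ''r'') (Var ''m''))) (Assign ''bi'' (Const n))) Skip)
        (\<lambda>t3. wp I (tries (Suc n) L) (\<lambda>t4 s'. search_state M I U F (length F) s' \<and> reg s' ''m0'' = m \<and>
          emitted s' = emitted s \<and> 1 + t1 + (1 + t2 + (1 + t3 + t4)) \<le>
            length (ds # L) * (400 * (b + 1) * (W + 1)) + 1)) s2"
      proof (cases "reg s2 ''best'' < reg s2 ''r'' - reg s2 ''m''")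
        case True
        define s3 where "s3 = s2\<lparr>reg := (reg s2)(''best'' := reg s2 ''r'' - reg s2 ''m'', ''bi'' := n)\<rparr>"
        have "best_of M I U F (Suc n) n"
          using ss(2,3) True regs card n by (intro best_of_new) auto
        then have "search_state M I U F (Suc n) s3"
          using ss(1) card n by (simp add: search_state_def saved_def s3_def)
        from next_try[OF this, of 20] True show ?thesis
          using regs em by (auto simp: wp_simps s3_def elim!: wp_mono)
      next
        case False
        have "best_of M I U F (Suc n) (reg s ''bi'')"
          using ss(2,3) False regs card n by (intro best_of_old sorted) auto
        then have "search_state M I U F (Suc n) s2" using ss regs by (simp add: search_state_def)
        from next_try[OF this, of 20] False show ?thesis
          using regs em by (auto simp: wp_simps elim!: wp_mono)
      qed
    qed
  qed
qed

text \<open>The test \<open>bi < Suc n\<close> amounts to equality, since the preceding tests have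
  excluded smaller values.\<close>

primrec pick :: "nat \<Rightarrow> bool list list \<Rightarrow> com" where
  "pick n [] = Skip"
| "pick n (ds # L) = If (Less (Var ''bi'') (Const (Suc n))) (path True ds) (pick (Suc n) L)"

text \<open>Each test costs four steps and their number depends on \<open>bi\<close>; requiring
  \<open>Q\<close> for every overhead \<open>u\<close> up to the maximum hides this
  dependence.\<close>

lemma wp_pick:
  assumes "n \<le> reg s ''bi''" "reg s ''bi'' < n + length L"
    and "wp I (path True (L ! (reg s ''bi'' - n))) (\<lambda>t s'. \<forall>u \<le> 4 * length L. Q (u + t) s') s"
  shows "wp I (pick n L) Q s"
  using assms
proof (induction L arbitrary: n Q)
  case (Cons ds L)
  show ?case
  proof (cases "reg s ''bi'' = n")
    case True
    have "wp I (path True ds) (\<lambda>t. Q (4 + t)) s"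
      using Cons.prems(3) unfolding True by (auto elim!: wp_mono dest: spec[of _ 4])
    then show ?thesis using True by (simp add: wp_simps eval_nat_numeral)
  next
    case False
    then have i: "(ds # L) ! (reg s ''bi'' - n) = L ! (reg s ''bi'' - Suc n)"
      using Cons.prems(1) by (simp add: nth_Cons')
    have "wp I (pick (Suc n) L) (\<lambda>t. Q (4 + t)) s"
    proof (rule Cons.IH)
      show "wp I (path True (L ! (reg s ''bi'' - Suc n))) (\<lambda>t s'. \<forall>u \<le> 4 * length L. Q (4 + (u + t)) s') s"
        using Cons.prems(3) unfolding i
      proof (rule wp_mono, intro allI impI)
        fix t s' u
        assume "\<forall>u \<le> 4 * length (ds # L). Q (u + t) s'" "u \<le> 4 * length L"
        then show "Q (4 + (u + t)) s'" by (auto simp flip: add.assoc dest: spec[of _ "4 + u"])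
      qed
    qed (use Cons.prems False in auto)
    then show ?thesis using Cons.prems(1) False by (simp add: wp_simps eval_nat_numeral)
  qed
qed simp


section \<open>The algorithm\<close>

text \<open>\<open>True\<close> merely fixes a direction for the closing run, whose purpose is to
  empty the buffer; a run in either direction does so.\<close>

definition window :: "nat \<Rightarrow> com" where
  "window k =
    Seq save
    (Seq (tries 0 (dirs k))
    (Seq restore
    (Seq (pick 0 (dirs k))
    (run True True))))"

definition window_result :: "nat \<Rightarrow> 'a::linorder list \<Rightarrow> nat \<Rightarrow> nat set \<Rightarrow> state \<Rightarrow>
    bool list \<Rightarrow> nat list list \<Rightarrow> nat list \<Rightarrow> state \<Rightarrow> bool" where
  "window_result M I k U s ds Xs Y s' \<longleftrightarrow> length ds \<le> k \<and>
    (\<forall>es. length es \<le> k \<longrightarrow> card (rests M I ds U) \<le> card (rests M I es U) \<and>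
      (card (rests M I ds U) = card (rests M I es U) \<longrightarrow> length ds \<le> length es)) \<and>
    length Xs \<le> length ds \<and> (\<forall>X\<in>set (Xs @ [Y]). \<exists>d. sorted_wrt (key_le I d) X) \<and>
    writable M U (concat Xs @ Y) \<and> rests M I ds U = U - set (concat Xs) \<and>
    rest M I True (rests M I ds U) = U - set (concat Xs @ Y) \<and>
    layout_state M I (U - set (concat Xs @ Y)) s' \<and> emitted s' = emitted s @ concat Xs @ Y"

text \<open>Every phase is at most a multiple of \<open>B\<close>, the product of the number of
  candidates, \<open>b + 1\<close> and the positions committed. The largest multiple, about 800,
  comes from the trials; all of them add up to less than 2000.\<close>

lemma window_cost:
  fixes W m x y l b u t1 t2 t3 t4 t5 :: nat
  assumes "1 \<le> W" "m \<le> W" "W \<le> x" "1 \<le> l"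
    "t1 \<le> 20 * m + 40" "t2 \<le> l * (400 * (b + 1) * (W + 1)) + 1" "t3 \<le> 20 * m + 40"
    "u \<le> 4 * l" "t4 \<le> 310 * (b + 1) * x + 5" "t5 \<le> 150 * (b + 1) * (y + 1)"
  shows "1 + t1 + (1 + t2 + (1 + t3 + (1 + (u + t4) + t5))) \<le> 2000 * l * (b + 1) * (x + y)"
proof -
  define B where "B = l * ((b + 1) * (x + y))"
  have B: "l * ((b + 1) * z) \<le> B" "(b + 1) * z \<le> B" "z \<le> B" if "z \<le> x + y" for z
  proof -
    show 1: "l * ((b + 1) * z) \<le> B" unfolding B_def using that by (intro mult_le_mono2)
    have "1 * ((b + 1) * z) \<le> l * ((b + 1) * z)" using assms(4) by (rule mult_le_mono1)
    then show 2: "(b + 1) * z \<le> B" using 1 by linarith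
    show "z \<le> B" using 2 by simp
  qed
  have "l \<le> B" using B(1)[of 1] assms(1,3) by (simp add: algebra_simps)
  moreover have "1 \<le> B" "m \<le> B" using assms(1-3) by (auto intro!: B(3))
  moreover have "l * (400 * (b + 1) * (W + 1)) \<le> 800 * B"
  proof -
    have "l * (400 * (b + 1) * (W + 1)) \<le> l * (400 * (b + 1) * (2 * W))" using assms(1) by (intro mult_le_mono2) simp
    also have "\<dots> = 800 * (l * ((b + 1) * W))" by (simp add: algebra_simps)
    also have "\<dots> \<le> 800 * B" using assms(3) by (intro mult_le_mono2 B(1)) simp
    finally show ?thesis .
  qed
  moreover have "310 * (b + 1) * x \<le> 310 * B" using B(2)[of x] by (simp add: algebra_simps)
  moreover have "150 * (b + 1) * (y + 1) \<le> 150 * B" using B(2)[of "y + 1"] assms(1,3) by (simp add: algebra_simps)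
  moreover have "2000 * l * (b + 1) * (x + y) = 2000 * B" by (simp add: B_def algebra_simps)
  ultimately show ?thesis using assms(5-10) by linarith
qed

lemma wp_window:
  assumes M: "1 \<le> M" and b: "length I < 2 ^ b" and k: "1 \<le> k"
    and l: "layout_state M I U s" and m: "1 \<le> reg s ''m''"
  shows "wp I (window k) (\<lambda>t s'. \<exists>ds Xs Y. window_result M I k U s ds Xs Y s' \<and>
    1 \<le> length (concat Xs @ Y) \<and>
    t \<le> 2000 * length (dirs k) * (b + 1) * length (concat Xs @ Y)) s"
proof -
  let ?F = "dirs k" and ?m = "reg s ''m''"
  define cmin where "cmin = Min ((\<lambda>es. card (rests M I es U)) ` set ?F)"
  \<comment> \<open>The largest number of positions that any candidate writes; the committed
    candidate attains it.\<close>
  define W where "W = card U - cmin"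
  have lay: "layout M (length I) (mem s) ?m (reg s ''r'') U" using l by (simp add: layout_state_def)
  note facts = layout_facts[OF lay]
  have cmin: "cmin \<le> card (rests M I es U)" if "es \<in> set ?F" for es
    unfolding cmin_def using that by (intro Min_le) auto
  \<comment> \<open>The one-run candidate \<open>[True]\<close>, available because
    \<open>1 \<le> k\<close>, already writes the whole buffer. Hence \<open>W\<close> covers the
    cost of copying it.\<close>
  have "cmin + ?m \<le> card U"
  proof -
    have "cmin \<le> card (rests M I [True] U)" using k by (intro cmin) (simp add: set_dirs)
    also have "\<dots> \<le> card (U - buffer M U)"
      using rest_buffer[of M I True U] facts(3) by (simp add: card_mono)
    also have "\<dots> + ?m = card U"
    proof -
      have "card (buffer M U) = ?m" using lay facts(1) by (simp add: layout_def card_image)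
      then show ?thesis using buffer_subset[of M U] facts(3)
        by (metis add.commute card_Diff_subset card_mono finite_subset le_add_diff_inverse)
    qed
    finally show ?thesis by simp
  qed
  then have W: "?m \<le> W" "card U = cmin + W" by (auto simp: W_def)
  have W': "\<forall>ds\<in>set ?F. card U \<le> card (rests M I ds U) + W" using cmin W(2) by auto
  show ?thesis
    unfolding window_def wp_simps(5)
  proof (rule wp_mono[OF wp_save[OF l]], elim conjE, goal_cases)
    case (1 t1 s1)
    then have s1: "search_state M I U ?F 0 s1"
      using dirs_0[of k] by (auto simp: search_state_def best_of_def)
    show ?case
    proof (rule wp_mono[OF wp_tries[OF M b sorted_dirs W' W(1) s1 1(3)]], simp, simp, elim conjE, goal_cases)
      case (1 t2 s2)
      then have sv: "saved M I U s2" by (simp add: search_state_def)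
      define i where "i = reg s2 ''bi''"
      have best: "best_of M I U ?F (length ?F) i" using 1(1) by (simp add: search_state_def i_def)
      note t2 = 1
      show ?case
      proof (rule wp_mono[OF wp_restore[OF sv]], elim conjE, goal_cases)
        case (1 t3 s3)
        note t3 = 1
        have i3: "reg s3 ''bi'' = i" using frame_regs[OF 1(3)] by (simp add: i_def)
        show ?case
        proof (rule wp_pick)
          show "0 \<le> reg s3 ''bi''" "reg s3 ''bi'' < 0 + length ?F"
            using best i3 by (auto simp: best_of_def)
          show "wp I (path True (?F ! (reg s3 ''bi'' - 0))) (\<lambda>t4 s4. \<forall>u\<le>4 * length ?F.
            wp I (run True True) (\<lambda>t5 s'. \<exists>ds Xs Y. window_result M I k U s ds Xs Y s' \<and>
              1 \<le> length (concat Xs @ Y) \<and>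
              1 + t1 + (1 + t2 + (1 + t3 + (1 + (u + t4) + t5)))
                \<le> 2000 * length ?F * (b + 1) * length (concat Xs @ Y)) s4) s3"
          proof (rule wp_mono[OF wp_path[OF M b 1(2)]], elim exE conjE, intro allI impI)
            fix t4 :: nat and s4 Xs u
            assume Xs: "path_result M I True (?F ! (reg s3 ''bi'' - 0)) U s3 Xs s4"
              and t4: "t4 \<le> 310 * (b + 1) * length (concat Xs) + 5" and u: "u \<le> 4 * length ?F"
            define ds where "ds = ?F ! i"
            have Xs: "path_result M I True ds U s3 Xs s4" using Xs i3 by (simp add: ds_def)
            then have l4: "layout_state M I (rests M I ds U) s4" unfolding path_result_def by blast
            have ds: "length ds \<le> k"
              using best set_dirs[of k] nth_mem[of i ?F] by (auto simp: best_of_def ds_def)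
            have ds_best: "card (rests M I ds U) \<le> card (rests M I es U) \<and>
              (card (rests M I ds U) = card (rests M I es U) \<longrightarrow> length ds \<le> length es)"
              if es: "length es \<le> k" for es
            proof -
              obtain j where "j < length ?F" "?F ! j = es"
                using es set_dirs[of k] by (metis in_set_conv_nth mem_Collect_eq)
              then show ?thesis using best by (auto simp: best_of_def ds_def)
            qed
            have "W \<le> length (concat Xs)"
            proof -
              have "cmin \<in> (\<lambda>es. card (rests M I es U)) ` set ?F"
                unfolding cmin_def using dirs_0[of k] by (intro Min_in) auto
              then have "card (rests M I ds U) \<le> cmin" using ds_best by (auto simp: set_dirs)
              moreover have "writable M U (concat Xs)" and rs: "rests M I ds U = U - set (concat Xs)"
                using Xs unfolding path_result_def by blast+
              then have "card (rests M I ds U) + length (concat Xs) = card U"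
                unfolding rs using facts(3) by (intro writable_card)
              ultimately show ?thesis using W(2) by simp
            qed
            show "wp I (run True True) (\<lambda>t5 s'. \<exists>ds Xs Y. window_result M I k U s ds Xs Y s' \<and>
              1 \<le> length (concat Xs @ Y) \<and>
              1 + t1 + (1 + t2 + (1 + t3 + (1 + (u + t4) + t5)))
                \<le> 2000 * length ?F * (b + 1) * length (concat Xs @ Y)) s4"
            proof (rule wp_mono[OF wp_run[OF l4 b]], elim exE conjE)
              fix t5 :: nat and s5 Y
              assume Y: "run_result M I True True (rests M I ds U) s4 Y s5"
                and t5: "t5 \<le> 150 * (b + 1) * (length Y + 1)"
              have rs: "rests M I ds U = U - set (concat Xs)" and w: "writable M U (concat Xs)"
                and em4: "emitted s4 = emitted s3 @ concat Xs"
                using Xs unfolding path_result_def emits_def by (blast, blast, simp)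
              have diff: "U - set (concat Xs @ Y) = U - set (concat Xs) - set Y" by auto
              have Y': "writable M (U - set (concat Xs)) Y" "sorted_wrt (key_le I True) Y"
                "rest M I True (rests M I ds U) = U - set (concat Xs) - set Y"
                "layout_state M I (U - set (concat Xs) - set Y) s5" "emitted s5 = emitted s4 @ Y"
                using Y unfolding run_result_def rs emits_def by simp_all
              have "window_result M I k U s ds Xs Y s5"
                unfolding window_result_def
              proof (intro conjI)
                show "\<forall>X\<in>set (Xs @ [Y]). \<exists>d. sorted_wrt (key_le I d) X"
                  using Xs Y'(2) by (auto simp: path_result_def)
                show "length Xs \<le> length ds" using Xs by (simp add: path_result_def)
                show "emitted s5 = emitted s @ concat Xs @ Y"
                  using Y'(5) em4 t3(4) t2 by (simp add: \<open>emitted s1 = emitted s\<close>)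
              qed (use ds ds_best w Y' rs diff in \<open>auto simp: writable_append\<close>)
              moreover have "1 \<le> length (concat Xs @ Y)"
                using \<open>W \<le> length (concat Xs)\<close> W(1) m by simp
              moreover have "1 \<le> length ?F" using dirs_0[of k] by (simp add: Suc_le_eq)
              then have "1 + t1 + (1 + t2 + (1 + t3 + (1 + (u + t4) + t5)))
                \<le> 2000 * length ?F * (b + 1) * length (concat Xs @ Y)"
                unfolding length_append
                by (intro window_cost[OF _ W(1) \<open>W \<le> length (concat Xs)\<close> _ _ _ _ u t4 t5])
                  (use t2 t3 W(1) m \<open>t1 \<le> 20 * ?m + 40\<close> in auto)
              ultimately show "\<exists>ds Xs Y. window_result M I k U s ds Xs Y s5 \<and>
                1 \<le> length (concat Xs @ Y) \<and>
                1 + t1 + (1 + t2 + (1 + t3 + (1 + (u + t4) + t5)))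
                  \<le> 2000 * length ?F * (b + 1) * length (concat Xs @ Y)" by blast
            qed
          qed
        qed
      qed
    qed
  qed
qed

text \<open>Heap cells are numbered from 1 and input positions from 0, so cell \<open>x\<close>
  starts with position \<open>x - 1\<close>.\<close>

definition setup_buffer :: com where
  "setup_buffer =
    Seq (If (Less (Var ''M'') (Var ''N'')) (Assign ''m'' (Var ''M'')) (Assign ''m'' (Var ''N'')))
    (Seq (Assign ''r'' (Var ''m''))
    (Seq (Assign ''q'' (Const 0))
    (While (Less (Var ''q'') (Var ''m''))
      (Seq (Assign ''q'' (Add (Var ''q'') (Const 1)))
      (Store (Var ''q'') (Sub (Var ''q'') (Const 1)))))))"

definition algorithm :: "nat \<Rightarrow> com" where
  "algorithm k = Seq setup_buffer (While (Less (Const 0) (Var ''m'')) (window k))"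

lemma wp_setup_buffer:
  "wp I setup_buffer (\<lambda>t s'. t \<le> 20 * length I + 40 \<and> layout_state M I {..<length I} s' \<and> emitted s' = [])
    (init M I)"
proof -
  define m where "m = min M (length I)"
  define s0 where "s0 = (init M I)\<lparr>reg := (reg (init M I))(''m'' := m, ''r'' := m, ''q'' := 0)\<rparr>"
  define P where "P s \<longleftrightarrow> reg s ''q'' \<le> m \<and> keeps {''q''} s0 s \<and> emitted s = [] \<and>
    (\<forall>x\<in>{1..reg s ''q''}. mem s x = x - 1)" for s
  define T where "T s = 20 * (m - reg s ''q'') + 10" for s :: state
  let ?body = "Seq (Assign ''q'' (Add (Var ''q'') (Const 1))) (Store (Var ''q'') (Sub (Var ''q'') (Const 1)))"
  have "wp I (While (Less (Var ''q'') (Var ''m'')) ?body)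
    (\<lambda>t s. P s \<and> \<not> bval I (Less (Var ''q'') (Var ''m'')) s \<and> t \<le> T s0) s0"
  proof (rule wp_While)
    show "P s0" by (auto simp: P_def s0_def keeps_def init_def)
  next
    fix s1 assume P: "P s1" and "bval I (Less (Var ''q'') (Var ''m'')) s1"
    then have q: "reg s1 ''q'' < m" by (auto simp: P_def keeps_def s0_def)
    then show "wp I ?body (\<lambda>t s'. P s' \<and> 1 + bcost (Less (Var ''q'') (Var ''m'')) + t + T s' \<le> T s1) s1"
      using P by (auto simp: wp_simps P_def T_def keeps_def)
  qed (auto simp: T_def)
  then have "wp I (While (Less (Var ''q'') (Var ''m'')) ?body)
    (\<lambda>t s. 20 + t \<le> 20 * length I + 40 \<and> layout_state M I {..<length I} s \<and> emitted s = []) s0"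
  proof (rule wp_mono, elim conjE)
    fix t s assume P: "P s" and nb: "\<not> bval I (Less (Var ''q'') (Var ''m'')) s" and t: "t \<le> T s0"
    have r: "reg s ''m'' = m" "reg s ''r'' = m" "reg s ''N'' = length I" "reg s ''q'' = m"
      using P nb by (auto simp: P_def keeps_def s0_def init_def)
    have mem: "mem s x = x - 1" if "x \<in> {1..m}" for x using P that r by (auto simp: P_def)
    have "mem s ` {1..m} = {..<m}"
    proof
      show "{..<m} \<subseteq> mem s ` {1..m}"
      proof
        fix x assume "x \<in> {..<m}"
        then show "x \<in> mem s ` {1..m}" using mem[of "Suc x"] by (intro image_eqI[of _ _ "Suc x"]) auto
      qed
    qed (use mem in auto)
    moreover have "inj_on (mem s) {1..m}" using mem by (auto simp: inj_on_def)
    ultimately have "layout_state M I {..<length I} s"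
      using r unwritten_start[of M "length I"] by (simp add: layout_state_def layout_def m_def)
    moreover have "m \<le> length I" by (simp add: m_def)
    ultimately show "20 + t \<le> 20 * length I + 40 \<and> layout_state M I {..<length I} s \<and> emitted s = []"
      using P t by (simp add: P_def T_def s0_def)
  qed
  then show ?thesis
    unfolding setup_buffer_def
    by (cases "M < length I") (auto simp: wp_simps s0_def m_def init_def elim!: wp_mono)
qed

section \<open>Amortised count of runs\<close>

text \<open>
  The directions \<open>ds\<close> are a way to finish, each charged \<open>1 + 1 / k\<close> runs. A window of \<open>k + 1\<close> runs
  pays for the first \<open>k\<close> entries of \<open>ds\<close>; if \<open>ds\<close> is not longer than \<open>k\<close>, the window finishes
  without using more runs than \<open>ds\<close>.
\<close>

definition on_schedule :: "nat \<Rightarrow> 'a::linorder list \<Rightarrow> nat \<Rightarrow> nat list list \<Rightarrow> bool list \<Rightarrow> bool" where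
  "on_schedule M I k Xs ds \<longleftrightarrow> (\<forall>X\<in>set Xs. \<exists>d. sorted_wrt (key_le I d) X) \<and>
    writable M {..<length I} (concat Xs) \<and> rests M I ds ({..<length I} - set (concat Xs)) = {} \<and>
    k * length Xs + (k + 1) * length ds \<le> (k + 1) * OPT M I"

text \<open>If \<open>es\<close> has at most \<open>k\<close> entries, it is itself a candidate that
  finishes, so the chosen one finishes too and is no longer. Otherwise \<open>take k es\<close> is a
  candidate: the chosen one leaves no more positions, the closing run turns this into an inclusion,
  and by monotonicity \<open>drop k es\<close> still finishes.\<close>

lemma on_schedule_window:
  assumes sched: "on_schedule M I k Xs es" and U: "U = {..<length I} - set (concat Xs)"
    and wf: "unwritten M (length I) B r U" and res: "window_result M I k U s ds Ys Z s'"
  shows "\<exists>Zs es'. concat Zs = concat Ys @ Z \<and> on_schedule M I k (Xs @ Zs) es'"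
proof -
  define V where "V = rests M I ds U"
  have fin: "finite U" unfolding U by simp
  have sorted: "\<forall>X\<in>set (Xs @ Ys @ [Z]). \<exists>d. sorted_wrt (key_le I d) X"
    using sched res unfolding on_schedule_def window_result_def by auto
  have w: "writable M {..<length I} (concat Xs @ concat Ys @ Z)"
    using sched res unfolding on_schedule_def window_result_def U by (subst writable_append) simp
  have es: "rests M I es U = {}" "k * length Xs + (k + 1) * length es \<le> (k + 1) * OPT M I"
    using sched unfolding on_schedule_def U by blast+
  have best: "card V \<le> card (rests M I fs U)" "card V = card (rests M I fs U) \<Longrightarrow> length ds \<le> length fs"
    if "length fs \<le> k" for fs
    using res that unfolding window_result_def V_def by blast+
  have len: "length Ys \<le> length ds" "length ds \<le> k" using res unfolding window_result_def by blast+
  have V: "V = U - set (concat Ys)" "rest M I True V = U - set (concat Ys @ Z)"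
    using res unfolding window_result_def V_def by blast+
  have finV: "finite V" using V(1) fin by simp
  show ?thesis
  proof (cases "length es \<le> k")
    case True
    then have "card V = card (rests M I es U)" using best(1)[of es] es(1) by simp
    then have "length Ys \<le> length es" using best(2)[OF True] len by simp
    have "V = {}" using \<open>card V = _\<close> es(1) finV by simp
    have "writable M V Z" using res V(1) by (simp add: window_result_def writable_append)
    \<comment> \<open>Nothing is left for the closing run. It is dropped from the list of runs and
      thus not counted.\<close>
    then have "Z = []" using writable_subset[of M V Z] \<open>V = {}\<close> by simp
    have "k * length Ys \<le> (k + 1) * length es" using \<open>length Ys \<le> length es\<close> by (intro mult_le_mono) auto
    then have "k * length (Xs @ Ys) \<le> (k + 1) * OPT M I" using es(2) by (simp add: algebra_simps)
    then have "on_schedule M I k (Xs @ Ys) []"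
      using sorted w \<open>V = {}\<close> V(1) \<open>Z = []\<close> unfolding on_schedule_def U by (auto simp: writable_append)
    then show ?thesis using \<open>Z = []\<close> by auto
  next
    case False
    let ?fs = "take k es" and ?gs = "drop k es"
    obtain C p D q where "unwritten M (length I) C p V" "unwritten M (length I) D q (rests M I ?fs U)"
      using unwritten_rests[OF wf] unfolding V_def by blast
    then have "rest M I True V \<subseteq> rests M I ?fs U"
      by (rule rest_subset_of_card_le) (simp add: best(1))
    moreover have "finite (rests M I ?fs U)" using rests_subset fin by (rule finite_subset)
    ultimately have "rests M I ?gs (rest M I True V) \<subseteq> rests M I ?gs (rests M I ?fs U)"
      by (intro rests_mono)
    then have "rests M I ?gs (rest M I True V) = {}"
      using es(1) by (simp flip: rests_append)
    moreover have "{..<length I} - set (concat (Xs @ Ys @ [Z])) = rest M I True V"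
      unfolding V(2) U by auto
    \<comment> \<open>At most \<open>k + 1\<close> new runs of weight \<open>k\<close> are exchanged
      for \<open>k\<close> directions of weight \<open>k + 1\<close>.\<close>
    moreover have "k * length (Xs @ Ys @ [Z]) + (k + 1) * length ?gs \<le> (k + 1) * OPT M I"
    proof -
      have "k * length (Ys @ [Z]) \<le> k * (k + 1)" using len by (intro mult_le_mono2) simp
      moreover have "(k + 1) * length ?gs + (k + 1) * k = (k + 1) * length es"
        using False by (simp flip: distrib_left)
      moreover have "k * length (Xs @ Ys @ [Z]) = k * length Xs + k * length (Ys @ [Z])"
        by (simp add: algebra_simps)
      moreover have "k * (k + 1) = (k + 1) * k" by simp
      ultimately show ?thesis using es(2) by linarith
    qed
    ultimately have "on_schedule M I k (Xs @ Ys @ [Z]) ?gs"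
      using sorted w by (simp add: on_schedule_def)
    then show ?thesis by (intro exI[of _ "Ys @ [Z]"]) auto
  qed
qed

lemma wp_algorithm:
  assumes M: "1 \<le> M" and b: "length I < 2 ^ b" and k: "1 \<le> k"
  shows "wp I (algorithm k) (\<lambda>t s. \<exists>Xs. emitted s = concat Xs \<and> strategy M (length I) (concat Xs) \<and>
    (\<forall>X\<in>set Xs. \<exists>d. sorted_wrt (key_le I d) X) \<and> k * length Xs \<le> (k + 1) * OPT M I \<and>
    t \<le> 3000 * length (dirs k) * (b + 1) * (length I + 1)) (init M I)"
proof -
  define K where "K = length (dirs k) * (b + 1)"
  have K: "1 \<le> K" using dirs_0[of k] by (simp add: K_def Suc_le_eq)
  define P where "P s \<longleftrightarrow> (\<exists>Xs ds. on_schedule M I k Xs ds \<and> emitted s = concat Xs \<and>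
    layout_state M I ({..<length I} - set (concat Xs)) s)" for s
  \<comment> \<open>Each unwritten position carries \<open>2000 * K\<close> steps for the window
    that will write it, and \<open>10 * K\<close> more to pay for the loop test, as every window
    writes at least one position.\<close>
  define T where "T s = 2010 * K * (reg s ''m'' + length I - reg s ''r'') + 10" for s :: state
  have card: "reg s ''m'' + length I - reg s ''r'' = card U" if "layout_state M I U s" for s U
    using layout_facts(2) that by (fastforce simp: layout_state_def)
  have loop: "wp I (While (Less (Const 0) (Var ''m'')) (window k))
    (\<lambda>t s'. P s' \<and> \<not> bval I (Less (Const 0) (Var ''m'')) s' \<and> t \<le> T s) s" if "P s" for s
  proof (rule wp_While)
    fix s1 assume "P s1" "bval I (Less (Const 0) (Var ''m'')) s1"
    then obtain Xs ds where sched: "on_schedule M I k Xs ds" and em: "emitted s1 = concat Xs"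
      and l: "layout_state M I ({..<length I} - set (concat Xs)) s1" and m: "1 \<le> reg s1 ''m''"
      by (auto simp: P_def)
    define U where "U = {..<length I} - set (concat Xs)"
    have l: "layout_state M I U s1" using l by (simp add: U_def)
    then have wf: "unwritten M (length I) (mem s1 ` {1..reg s1 ''m''}) (reg s1 ''r'') U"
      by (simp add: layout_state_def layout_def)
    show "wp I (window k) (\<lambda>t s'. P s' \<and> 1 + bcost (Less (Const 0) (Var ''m'')) + t + T s' \<le> T s1) s1"
    proof (rule wp_mono[OF wp_window[OF M b k l m]], elim exE conjE)
      fix t s2 es Ys Z
      assume res: "window_result M I k U s1 es Ys Z s2" and len: "1 \<le> length (concat Ys @ Z)"
        and t: "t \<le> 2000 * length (dirs k) * (b + 1) * length (concat Ys @ Z)"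
      obtain Zs es' where Zs: "concat Zs = concat Ys @ Z" "on_schedule M I k (Xs @ Zs) es'"
        using on_schedule_window[OF sched U_def wf res] by blast
      have l2: "layout_state M I (U - set (concat Ys @ Z)) s2" and em2: "emitted s2 = emitted s1 @ concat Ys @ Z"
        and w: "writable M U (concat Ys @ Z)"
        using res unfolding window_result_def by blast+
      have "U - set (concat Ys @ Z) = {..<length I} - set (concat (Xs @ Zs))"
        unfolding U_def Zs(1) concat_append by auto
      then have "P s2" unfolding P_def using Zs l2 em em2 by (intro exI[of _ "Xs @ Zs"] exI[of _ es']) simp
      moreover have "4 + t + T s2 \<le> T s1"
      proof -
        let ?l = "length (concat Ys @ Z)"
        have "card U = card (U - set (concat Ys @ Z)) + ?l"
          using writable_card[OF w] by (simp add: U_def)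
        then have "T s1 = T s2 + 2010 * K * ?l"
          unfolding T_def card[OF l] card[OF l2] by (simp only: distrib_left)
        moreover have "t \<le> 2000 * K * ?l" using t by (simp add: K_def mult.assoc)
        moreover have "1 \<le> K * ?l" using K len by simp
        ultimately show ?thesis by linarith
      qed
      ultimately show "P s2 \<and> 1 + bcost (Less (Const 0) (Var ''m'')) + t + T s2 \<le> T s1" by simp
    qed
  qed (use that in \<open>auto simp: T_def\<close>)
  show ?thesis
    unfolding algorithm_def wp_simps(5)
  proof (rule wp_mono[OF wp_setup_buffer[where M = M]], elim conjE)
    fix t :: nat and s
    assume t: "t \<le> 20 * length I + 40" and l: "layout_state M I {..<length I} s" and em: "emitted s = []"
    obtain ds where "length ds = OPT M I" "rests M I ds {..<length I} = {}"
      using OPT_directions[OF M] by blast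
    then have "on_schedule M I k [] ds" by (simp add: on_schedule_def)
    then have "P s" unfolding P_def using l em by (intro exI[of _ "[]"] exI[of _ ds]) simp
    from loop[OF this] show "wp I (While (Less (Const 0) (Var ''m'')) (window k))
      (\<lambda>t' s. \<exists>Xs. emitted s = concat Xs \<and> strategy M (length I) (concat Xs) \<and>
        (\<forall>X\<in>set Xs. \<exists>d. sorted_wrt (key_le I d) X) \<and> k * length Xs \<le> (k + 1) * OPT M I \<and>
        1 + t + t' \<le> 3000 * length (dirs k) * (b + 1) * (length I + 1)) s"
    proof (rule wp_mono, elim conjE)
      fix t' s' assume "P s'" and nb: "\<not> bval I (Less (Const 0) (Var ''m'')) s'" and t': "t' \<le> T s"
      then obtain Xs es where sched: "on_schedule M I k Xs es" and em: "emitted s' = concat Xs"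
        and l': "layout_state M I ({..<length I} - set (concat Xs)) s'"
        by (auto simp: P_def)
      have m0: "reg s' ''m'' = 0" using nb by simp
      have "layout M (length I) (mem s') 0 (reg s' ''r'') ({..<length I} - set (concat Xs))"
        using l' by (simp add: layout_state_def m0)
      then have "{..<length I} - set (concat Xs) = {}" using M by (rule layout_empty)
      moreover have w: "writable M {..<length I} (concat Xs)" using sched unfolding on_schedule_def by blast
      ultimately have "strategy M (length I) (concat Xs)"
        using writable_subset[OF w] unfolding strategy_writable by blast
      moreover have "k * length Xs \<le> (k + 1) * OPT M I" "\<forall>X\<in>set Xs. \<exists>d. sorted_wrt (key_le I d) X"
        using sched unfolding on_schedule_def by auto
      moreover have "1 + t + t' \<le> 3000 * length (dirs k) * (b + 1) * (length I + 1)"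
      proof -
        have "T s = 2010 * (K * length I) + 10" using card[OF l] by (simp add: T_def)
        moreover have "length I \<le> K * length I" using K by simp
        moreover have "3000 * length (dirs k) * (b + 1) * (length I + 1) = 3000 * (K * length I) + 3000 * K"
          by (simp add: K_def algebra_simps)
        ultimately show ?thesis using t t' K by linarith
      qed
      ultimately show "\<exists>Xs. emitted s' = concat Xs \<and> strategy M (length I) (concat Xs) \<and>
        (\<forall>X\<in>set Xs. \<exists>d. sorted_wrt (key_le I d) X) \<and> k * length Xs \<le> (k + 1) * OPT M I \<and>
        1 + t + t' \<le> 3000 * length (dirs k) * (b + 1) * (length I + 1)"
        using em by blast
    qed
  qed
qed

section \<open>The logarithm and the final constants\<close>

text \<open>With \<open>b\<close> one more than the integer part of the logarithm,
  \<open>b + 1\<close> is at most \<open>log 2 N + 2\<close>, and \<open>1 \<le> log 2 N\<close>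
  turns this into the factor 3.\<close>

lemma log_bound:
  obtains b where "N < 2 ^ b" "2 \<le> N \<Longrightarrow> real (b + 1) \<le> 3 * log 2 (real N)"
proof (cases "2 \<le> N")
  case True
  define b where "b = nat \<lfloor>log 2 (real N)\<rfloor> + 1"
  have l: "1 \<le> log 2 (real N)" using True by (simp add: le_log_iff)
  have b: "real b = real_of_int \<lfloor>log 2 (real N)\<rfloor> + 1" using l by (simp add: b_def)
  have "real N = 2 powr log 2 (real N)" using True by simp
  also have "\<dots> < 2 powr real b" using b by (intro powr_less_mono) linarith+
  also have "\<dots> = real (2 ^ b)" by (simp add: powr_realpow)
  finally have "N < 2 ^ b" by (simp only: of_nat_less_iff)
  moreover have "real (b + 1) \<le> 3 * log 2 (real N)" using b l by simp linarith
  ultimately show ?thesis using that by blast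
next
  case False
  then show ?thesis using that[of 1] by simp
qed

text \<open>The time bound starts at length 2 because \<open>log 2 1 = 0\<close>, while any
  execution takes at least one step.\<close>

theorem theorem11:
  "\<exists>C::real. \<forall>\<epsilon>::real. \<epsilon> > 0 \<longrightarrow>
     (\<exists>A::com. \<forall>(M::nat) (I::'a::linorder list). M \<ge> 1 \<longrightarrow>
       (\<exists>t ps. computes A M I t ps \<and>
          strategy M (length I) ps \<and>
          real (R (written I ps)) \<le> (1 + \<epsilon>) * real (OPT M I) \<and>
          (length I \<ge> 2 \<longrightarrow>
             real t \<le> C * 2 powr (1 / \<epsilon>) * real (length I) * log 2 (real (length I)))))"
proof (intro exI[of _ "72000"] allI impI)
  fix \<epsilon> :: real
  assume "\<epsilon> > 0"
  \<comment> \<open>Rounding up gives \<open>1 \<le> k * \<epsilon>\<close>, so \<open>k + 1\<close>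
    runs in place of \<open>k\<close> stay within the factor \<open>1 + \<epsilon>\<close>; rounding
    by less than one costs at most a factor 2 in \<open>2 powr k\<close>.\<close>
  define k where "k = nat \<lceil>1 / \<epsilon>\<rceil>"
  have k: "1 \<le> k" "1 / \<epsilon> \<le> real k" "real k \<le> 1 / \<epsilon> + 1"
    using \<open>\<epsilon> > 0\<close> by (auto simp: k_def le_nat_iff less_ceiling_iff Suc_le_eq)
  show "\<exists>A::com. \<forall>(M::nat) (I::'a list). M \<ge> 1 \<longrightarrow>
       (\<exists>t ps. computes A M I t ps \<and> strategy M (length I) ps \<and>
          real (R (written I ps)) \<le> (1 + \<epsilon>) * real (OPT M I) \<and>
          (length I \<ge> 2 \<longrightarrow>
             real t \<le> 72000 * 2 powr (1 / \<epsilon>) * real (length I) * log 2 (real (length I))))"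
  proof (intro exI[of _ "algorithm k"] allI impI)
    fix M :: nat and I :: "'a list"
    assume M: "M \<ge> 1"
    obtain b where b: "length I < 2 ^ b" "2 \<le> length I \<Longrightarrow> real (b + 1) \<le> 3 * log 2 (real (length I))"
      using log_bound by blast
    obtain t s Xs where run: "exec I (algorithm k) (init M I) t s" "emitted s = concat Xs"
      and strat: "strategy M (length I) (concat Xs)"
      and sorted: "\<forall>X\<in>set Xs. \<exists>d. sorted_wrt (key_le I d) X"
      and len: "k * length Xs \<le> (k + 1) * OPT M I"
      and t: "t \<le> 3000 * length (dirs k) * (b + 1) * (length I + 1)"
      using wp_algorithm[OF M b(1) k(1)] unfolding wp_def by blast
    have "real (R (written I (concat Xs))) \<le> (1 + \<epsilon>) * real (OPT M I)"
    proof -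
      have "real k * real (R (written I (concat Xs))) \<le> real k * real (length Xs)"
        using R_le_length[OF sorted] by (intro mult_left_mono) auto
      also have "\<dots> = real (k * length Xs)" by simp
      also have "\<dots> \<le> real ((k + 1) * OPT M I)" using len by (simp only: of_nat_le_iff)
      also have "\<dots> = (real k + 1) * real (OPT M I)" by (simp add: algebra_simps)
      also have "\<dots> \<le> (real k + real k * \<epsilon>) * real (OPT M I)"
        using k(2) \<open>\<epsilon> > 0\<close> by (intro mult_right_mono) (simp_all add: divide_le_eq)
      also have "\<dots> = real k * ((1 + \<epsilon>) * real (OPT M I))" by (simp add: algebra_simps)
      finally show ?thesis using k(1) by simp
    qed
    moreover have "real t \<le> 72000 * 2 powr (1 / \<epsilon>) * real (length I) * log 2 (real (length I))"
      if "2 \<le> length I"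
    proof -
      have "real (length (dirs k)) \<le> 2 ^ Suc k" using length_dirs[of k]
        by (metis le_add1 of_nat_le_iff of_nat_numeral of_nat_power)
      also have "\<dots> = 2 * 2 powr real k" by (simp add: powr_realpow)
      also have "\<dots> \<le> 2 * 2 powr (1 / \<epsilon> + 1)" using k(3) by (intro mult_left_mono powr_mono) auto
      also have "\<dots> = 4 * 2 powr (1 / \<epsilon>)" by (simp add: powr_add)
      finally have F: "real (length (dirs k)) \<le> 4 * 2 powr (1 / \<epsilon>)" .
      have "real t \<le> real (3000 * length (dirs k) * (b + 1) * (length I + 1))"
        using t by (simp only: of_nat_le_iff)
      also have "\<dots> = 3000 * (real (length (dirs k)) * (real (b + 1) * real (length I + 1)))" by (simp add: algebra_simps)
      \<comment> \<open>72000 is \<open>3000 * 4 * 3 * 2\<close>: 4 from the number of candidates, 3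
        from \<open>log_bound\<close>, and 2 from
        \<open>length I + 1 \<le> 2 * length I\<close>.\<close>
      also have "\<dots> \<le> 3000 * ((4 * 2 powr (1 / \<epsilon>)) * ((3 * log 2 (real (length I))) * (2 * real (length I))))"
        using F b(2)[OF that] that by (intro mult_left_mono mult_mono) auto
      finally show ?thesis by (simp add: algebra_simps)
    qed
    ultimately show "\<exists>t ps. computes (algorithm k) M I t ps \<and> strategy M (length I) ps \<and>
          real (R (written I ps)) \<le> (1 + \<epsilon>) * real (OPT M I) \<and>
          (length I \<ge> 2 \<longrightarrow>
             real t \<le> 72000 * 2 powr (1 / \<epsilon>) * real (length I) * log 2 (real (length I)))"
      using run strat unfolding computes_def by blast
  qed
qed

end
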